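(* Let $k\in\mathbb{N}$, let $\phi,\psi,\eta,\xi,a,b>0$ be real numbers and let $P,Q,R,S\in\mathscr{M}_k$. Then $$\mathfrak{BL}_{(\phi,\psi)}^{(R,S,\eta,\xi)}(a,b;P,Q)=\sum_{n=0}^{\infty}\mathfrak{BL}_{(\phi,\psi)}^{(R,S,\eta,\xi)}(a,b;P+I,Q+nI)$$ and $$\mathfrak{BL}_{(\phi,\psi)}^{(R,S,\eta,\xi)}(a,b;P,Q)=\sum_{n=0}^{\infty}\mathfrak{BL}_{(\phi,\psi)}^{(R,S,\eta,\xi)}(a,b;P+nI,Q+I).$$
   Context: $\mathscr{M}_k$ is the set of $k\times k$ complex Hermitian matrices that are positive stable (all eigenvalues have positive real part). $I$ is the $k\times k$ identity matrix. For $x>0$ and a square matrix $A$, $x^{A}=\exp(A\ln x)$. The two-parameter Mittag-Leffler matrix function is $\mathcal{E}_{(\phi,\psi)}(A)=\sum_{n=0}^{\infty}\frac{A^n}{\Gamma(\phi n+\psi)}$ for $\phi,\psi>0$. For real $\phi,\psi,\eta,\xi,a,b>0$ and $P,Q,R,S\in\mathscr{M}_k$ the generalized beta-logarithmic matrix function is $$\mathfrak{BL}_{(\phi,\psi)}^{(R,S,\eta,\xi)}(a,b;P,Q)=\int_{0}^{1}a^{1-x}b^{x}x^{P-I}(1-x)^{Q-I}\mathcal{E}_{(\phi,\psi)}\left(-\frac{R}{x^{\eta}}\right)\mathcal{E}_{(\phi,\psi)}\left(-\frac{S}{(1-x)^{\xi}}\right)dx,$$ with matrix products taken in the written order.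
   Formalization: For φ ≥ 2 the integral defining BL(a,b;P,Q) on the left is additionally assumed to converge (possibly conditionally), since for φ > 2 it diverges in general (e.g. k = 1) and the claim is then undefined; for φ < 2 nothing is added. *)

theory Defs
  imports "HOL-Analysis.Analysis"
begin

text \<open>
  A k-by-k complex matrix has type \<open>complex^'k^'k\<close> with \<open>'k\<close> a finite type of cardinality k.
  Limits and infinite sums of matrices are in the product topology, that is, entrywise.
\<close>

definition hermitian :: "complex^'k^'k \<Rightarrow> bool" where
  "hermitian A \<longleftrightarrow> (\<forall>i j. A $ i $ j = cnj (A $ j $ i))"

definition eigenvalue :: "complex^'k^'k \<Rightarrow> complex \<Rightarrow> bool" where
  "eigenvalue A l \<longleftrightarrow> (\<exists>v. v \<noteq> 0 \<and> A *v v = l *s v)"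

definition pos_stable_hermitian :: "(complex^'k^'k) set" where
  "pos_stable_hermitian = {A. hermitian A \<and> (\<forall>l. eigenvalue A l \<longrightarrow> 0 < Re l)}"

text \<open>The library's product \<open>*\<close> and power \<open>^\<close> on vectors are componentwise; the matrix product is \<open>**\<close>.\<close>

primrec matrix_power :: "complex^'k^'k \<Rightarrow> nat \<Rightarrow> complex^'k^'k" where
  "matrix_power A 0 = mat 1"
| "matrix_power A (Suc n) = A ** matrix_power A n"

definition matrix_exp :: "complex^'k^'k \<Rightarrow> complex^'k^'k" where
  "matrix_exp A = (\<Sum>n. (1 / fact n) *\<^sub>R matrix_power A n)"

definition powr_matrix :: "real \<Rightarrow> complex^'k^'k \<Rightarrow> complex^'k^'k" where
  "powr_matrix x A = matrix_exp (ln x *\<^sub>R A)"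

definition mittag_leffler :: "real \<Rightarrow> real \<Rightarrow> complex^'k^'k \<Rightarrow> complex^'k^'k" where
  "mittag_leffler \<phi> \<psi> A = (\<Sum>n. (1 / Gamma (\<phi> * real n + \<psi>)) *\<^sub>R matrix_power A n)"

definition beta_log_integrand ::
    "real \<Rightarrow> real \<Rightarrow> complex^'k^'k \<Rightarrow> complex^'k^'k \<Rightarrow> real \<Rightarrow> real \<Rightarrow> real \<Rightarrow> real
      \<Rightarrow> complex^'k^'k \<Rightarrow> complex^'k^'k \<Rightarrow> real \<Rightarrow> complex^'k^'k" where
  "beta_log_integrand \<phi> \<psi> R S \<eta> \<xi> a b P Q x =
     (a powr (1 - x) * b powr x) *\<^sub>R
       (powr_matrix x (P - mat 1) ** powr_matrix (1 - x) (Q - mat 1)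
         ** mittag_leffler \<phi> \<psi> (- ((1 / x powr \<eta>) *\<^sub>R R))
         ** mittag_leffler \<phi> \<psi> (- ((1 / (1 - x) powr \<xi>) *\<^sub>R S)))"

text \<open>
  The integral is the Henstock-Kurzweil integral, which covers both Lebesgue integrals and
  conditionally convergent improper integrals at the endpoints 0 and 1.
  For \<open>\<phi> < 2\<close> it always converges, because \<open>t \<mapsto> E(-t)\<close> is bounded on \<open>t \<ge> 0\<close>.
  For \<open>\<phi> = 2\<close> the integrand need not be absolutely integrable, and for \<open>\<phi> > 2\<close> the function
  \<open>E(-t)\<close> grows exponentially along \<open>t \<rightarrow> \<infinity>\<close>, so convergence cannot be taken for granted there;
  \<open>integral\<close> is 0 where the integral diverges.
\<close>

definition beta_log ::
    "real \<Rightarrow> real \<Rightarrow> complex^'k^'k \<Rightarrow> complex^'k^'k \<Rightarrow> real \<Rightarrow> real \<Rightarrow> real \<Rightarrow> real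
      \<Rightarrow> complex^'k^'k \<Rightarrow> complex^'k^'k \<Rightarrow> complex^'k^'k" where
  "beta_log \<phi> \<psi> R S \<eta> \<xi> a b P Q =
     integral {0..1} (beta_log_integrand \<phi> \<psi> R S \<eta> \<xi> a b P Q)"

definition beta_log_converges ::
    "real \<Rightarrow> real \<Rightarrow> complex^'k^'k \<Rightarrow> complex^'k^'k \<Rightarrow> real \<Rightarrow> real \<Rightarrow> real \<Rightarrow> real
      \<Rightarrow> complex^'k^'k \<Rightarrow> complex^'k^'k \<Rightarrow> bool" where
  "beta_log_converges \<phi> \<psi> R S \<eta> \<xi> a b P Q \<longleftrightarrow>
     beta_log_integrand \<phi> \<psi> R S \<eta> \<xi> a b P Q integrable_on {0..1}"

end

theory Submission
  imports Defs "HOL-Complex_Analysis.Complex_Analysis"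
begin

text \<open>
  Raising \<open>P\<close> by \<open>m I\<close> and \<open>Q\<close> by \<open>n I\<close> multiplies the integrand \<open>F\<close> by \<open>x\<^sup>m (1 - x)\<^sup>n\<close> on \<open>(0, 1)\<close>, so
  both series telescope and the remainders after \<open>N\<close> terms are \<open>\<integral> (1 - x)\<^sup>N F\<close> and \<open>\<integral> x\<^sup>N F\<close>. These tend
  to 0 for every Henstock-Kurzweil integrable \<open>F\<close>, by the second mean value theorem.

  For \<open>\<phi> < 2\<close> integrability must be proved. By the spectral theorem the matrix functions reduce to
  their values at positive reals, and \<open>F\<close> is dominated by a Beta integrand as soon as
  \<open>t \<mapsto> E(-t)\<close> is bounded on \<open>t \<ge> 0\<close>. For this, \<open>\<Sum>n\<le>N. (-t)\<^sup>n / \<Gamma>(\<phi> n + \<psi>)\<close> is, up to a constant factor, the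
  integral of \<open>t\<^sup>s / (\<Gamma>(\<phi> s + \<psi>) sin (\<pi> s))\<close> around a rectangle with vertical sides
  \<open>Re s = -1/2\<close> and \<open>Re s = N + 1/2\<close>. On vertical lines \<open>1 / \<Gamma>(\<phi> s + \<psi>)\<close> grows like
  \<open>exp (\<pi> \<phi> \<bar>Im s\<bar> / 2)\<close> up to powers, and the sine wins exactly because \<open>\<phi> < 2\<close>.
\<close>

subsection \<open>Spectral decomposition\<close>

text \<open>A maximiser \<open>u\<close> of the Rayleigh quotient on the unit sphere of
  \<open>V\<close> is an eigenvector: the form \<open>B\<close> is nonnegative on \<open>V\<close>
  and vanishes at \<open>u\<close>, so its first variation at \<open>u\<close> is zero. The
  invariant subspace lets the lemma be applied to an orthogonal complement.\<close>

lemma selfadjoint_eigenvector_exists: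
  fixes f :: "'a::euclidean_space \<Rightarrow> 'a"
  assumes lin: "linear f" and sym: "\<And>x y. f x \<bullet> y = x \<bullet> f y"
    and V: "subspace V" "\<And>x. x \<in> V \<Longrightarrow> f x \<in> V" and ne: "x0 \<in> V" "x0 \<noteq> 0"
  obtains u l where "u \<in> V" "u \<noteq> 0" "f u = l *\<^sub>R u"
proof -
  interpret linear f by fact
  have cont: "continuous_on A f" for A
    using lin linear_continuous_on linear_linear by blast
  have "compact (sphere 0 1 \<inter> V)"
    by (intro compact_Int_closed closed_subspace V) auto
  moreover have "(1 / norm x0) *\<^sub>R x0 \<in> sphere 0 1 \<inter> V"
    using ne V by (auto simp: subspace_scale)
  then have "sphere 0 1 \<inter> V \<noteq> {}" by blast
  ultimately have "\<exists>u\<in>sphere 0 1 \<inter> V. \<forall>v\<in>sphere 0 1 \<inter> V. f v \<bullet> v \<le> f u \<bullet> u"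
    by (intro continuous_attains_sup continuous_intros cont)
  then obtain u where u: "u \<in> sphere 0 1 \<inter> V"
    and max: "\<And>v. v \<in> sphere 0 1 \<inter> V \<Longrightarrow> f v \<bullet> v \<le> f u \<bullet> u"
    by blast
  define l where "l = f u \<bullet> u"
  define B where "B = (\<lambda>v. l * (v \<bullet> v) - f v \<bullet> v)"
  define h where "h = f u - l *\<^sub>R u"
  have uV: "u \<in> V" and nu: "norm u = 1" using u by auto
  have hV: "h \<in> V" unfolding h_def using uV V by (simp add: subspace_diff subspace_scale)
  have B_nonneg: "B v \<ge> 0" if "v \<in> V" for v
  proof (cases "v = 0")
    case False
    define w where "w = (1 / norm v) *\<^sub>R v"
    have "w \<in> sphere 0 1 \<inter> V" using False that V by (auto simp: w_def subspace_scale)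
    then have "f w \<bullet> w \<le> l" using max l_def by auto
    then have "(f v \<bullet> v) / (norm v)\<^sup>2 \<le> l"
      by (simp add: w_def scaleR power2_eq_square)
    then show ?thesis using False
      by (simp add: B_def field_simps power2_norm_eq_inner)
  qed (simp add: B_def zero)
  \<comment> \<open>Since \<open>B u = 0\<close>, only a linear and a quadratic term in
    \<open>e\<close> remain; \<open>h\<close> is chosen so that the linear coefficient is minus
    twice its own squared norm.\<close>
  have Bh: "B (u + e *\<^sub>R h) = e\<^sup>2 * B h - 2 * e * (h \<bullet> h)" for e
  proof -
    have fh: "f h \<bullet> u = f u \<bullet> h" using sym[of h u] by (simp add: inner_commute)
    have uu: "u \<bullet> u = 1" using nu by (simp add: dot_square_norm)
    have "h \<bullet> h = f u \<bullet> h - l * (u \<bullet> h)" by (subst h_def) (simp add: inner_diff_left)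
    moreover have "B (u + e *\<^sub>R h) = e\<^sup>2 * B h - 2 * e * (f u \<bullet> h - l * (u \<bullet> h))"
      using fh uu l_def
      by (simp add: B_def add scaleR inner_add_left inner_add_right algebra_simps power2_eq_square inner_commute)
    ultimately show ?thesis by simp
  qed
  have "h \<bullet> h = 0"
  proof (rule ccontr)
    assume "h \<bullet> h \<noteq> 0"
    then have hh: "h \<bullet> h > 0" by simp
    have Bh0: "B h \<ge> 0" using B_nonneg hV by auto
    \<comment> \<open>With this \<open>e\<close> the quadratic term is at most half the size of the
      linear one, so \<open>B\<close> would be negative at \<open>u + e h\<close>. The summand 1
      keeps the denominator positive.\<close>
    define e where "e = (h \<bullet> h) / (1 + B h)"
    have e: "e > 0" using hh Bh0 by (simp add: e_def)
    have "u + e *\<^sub>R h \<in> V" using uV hV V by (simp add: subspace_add subspace_scale)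
    then have "0 \<le> e * (e * B h - 2 * (h \<bullet> h))" 
      using B_nonneg[of "u + e *\<^sub>R h"] Bh by (simp add: algebra_simps power2_eq_square)
    then have "2 * (h \<bullet> h) \<le> e * B h" using e by (simp add: zero_le_mult_iff)
    moreover have "e * B h \<le> e * (1 + B h)" using e by simp
    moreover have "e * (1 + B h) = h \<bullet> h" using Bh0 by (simp add: e_def)
    ultimately show False using hh by linarith
  qed
  then have "f u = l *\<^sub>R u" by (simp add: h_def)
  then show ?thesis using that uV nu by (metis norm_zero zero_neq_one)
qed

text \<open>The sums of eigenvectors form an invariant subspace \<open>W\<close>. If it were proper,
  its orthogonal complement would be nonzero and, by symmetry of \<open>f\<close>, invariant; an
  eigenvector found there also lies in \<open>W\<close>, hence is orthogonal to itself. Indexing by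
  the eigenvalue and letting \<open>w l\<close> be 0 makes two decompositions add pointwise.\<close>

lemma selfadjoint_eigenvector_decomposition:
  fixes f :: "'a::euclidean_space \<Rightarrow> 'a"
  assumes lin: "linear f" and sym: "\<And>x y. f x \<bullet> y = x \<bullet> f y"
  obtains L w where "finite L" "v = sum w L" "\<And>l. l \<notin> L \<Longrightarrow> w l = 0" "\<And>l. f (w l) = l *\<^sub>R w l"
proof -
  interpret linear f by fact
  define W where "W = {v. \<exists>L w. finite L \<and> v = sum w L \<and> (\<forall>l. l \<notin> L \<longrightarrow> w l = 0) \<and> (\<forall>l. f (w l) = l *\<^sub>R w l)}"
  have sub: "subspace W"
    unfolding subspace_def
  proof (intro conjI ballI allI)
    show "0 \<in> W" unfolding W_def using zero
      by (intro CollectI exI[of _ "{}"] exI[of _ "\<lambda>_. 0"]) auto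
  next
    fix x y assume "x \<in> W" "y \<in> W"
    then obtain L1 w1 L2 w2 where 
      1: "finite L1" "x = sum w1 L1" "\<forall>l. l \<notin> L1 \<longrightarrow> w1 l = 0" "\<forall>l. f (w1 l) = l *\<^sub>R w1 l" and
      2: "finite L2" "y = sum w2 L2" "\<forall>l. l \<notin> L2 \<longrightarrow> w2 l = 0" "\<forall>l. f (w2 l) = l *\<^sub>R w2 l"
      unfolding W_def by blast
    have "x = sum w1 (L1 \<union> L2)" "y = sum w2 (L1 \<union> L2)"
      unfolding 1(2) 2(2) using 1 2 by (auto intro!: sum.mono_neutral_left)
    then have "x + y = (\<Sum>l\<in>L1 \<union> L2. w1 l + w2 l)" by (simp add: sum.distrib)
    then show "x + y \<in> W" unfolding W_def using 1 2
      by (intro CollectI exI[of _ "L1 \<union> L2"] exI[of _ "\<lambda>l. w1 l + w2 l"])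
         (simp add: add scaleR_right_distrib)
  next
    fix c x assume "x \<in> W"
    then obtain L1 w1 where 
      1: "finite L1" "x = sum w1 L1" "\<forall>l. l \<notin> L1 \<longrightarrow> w1 l = 0" "\<forall>l. f (w1 l) = l *\<^sub>R w1 l"
      unfolding W_def by blast
    then show "c *\<^sub>R x \<in> W" unfolding W_def
      by (intro CollectI exI[of _ "L1"] exI[of _ "\<lambda>l. c *\<^sub>R w1 l"])
         (simp add: scaleR scaleR_sum_right)
  qed
  have eig: "u \<in> W" if "f u = l *\<^sub>R u" for u l
    unfolding W_def using that zero
    by (intro CollectI exI[of _ "{l}"] exI[of _ "\<lambda>k. if k = l then u else 0"]) auto
  have fW: "f x \<in> W" if "x \<in> W" for x
  proof -
    from that obtain L1 w1 where 
      1: "finite L1" "x = sum w1 L1" "\<forall>l. l \<notin> L1 \<longrightarrow> w1 l = 0" "\<forall>l. f (w1 l) = l *\<^sub>R w1 l"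
      unfolding W_def by blast
    then have "f x = (\<Sum>l\<in>L1. l *\<^sub>R w1 l)" by (simp add: sum)
    with 1 show "f x \<in> W" unfolding W_def
      by (intro CollectI exI[of _ "L1"] exI[of _ "\<lambda>l. l *\<^sub>R w1 l"]) (simp add: scaleR)
  qed
  have "W = UNIV"
  proof (rule ccontr)
    assume "W \<noteq> UNIV"
    then have "span W \<subset> span UNIV" using sub by (metis psubsetI span_UNIV span_eq_iff top_greatest)
    then obtain x0 where x0: "x0 \<noteq> 0" "\<And>y. y \<in> span W \<Longrightarrow> orthogonal x0 y"
      by (metis orthogonal_to_subspace_exists_gen)
    define V where "V = {x. \<forall>y\<in>W. x \<bullet> y = 0}"
    have "subspace V" unfolding V_def subspace_def by (auto simp: inner_add_left)
    moreover have "f x \<in> V" if "x \<in> V" for x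
      using that fW unfolding V_def by (auto simp: sym)
    moreover have "x0 \<in> V" unfolding V_def using x0 by (auto simp: orthogonal_def span_base)
    ultimately obtain u l where u: "u \<in> V" "u \<noteq> 0" "f u = l *\<^sub>R u"
      using selfadjoint_eigenvector_exists[OF lin sym, of V x0] x0 by metis
    then have "u \<bullet> u = 0" using eig[of u l] unfolding V_def by auto
    then show False using u by simp
  qed
  then show ?thesis using that unfolding W_def by blast
qed

text \<open>The inner product here is the real part of the Hermitian one, so the real spectral
  argument applies and delivers real eigenvalues directly.\<close>

lemma hermitian_inner:
  assumes "hermitian A"
  shows "(A *v x) \<bullet> y = x \<bullet> (A *v y)"
proof -
  have herm: "A $ i $ j = cnj (A $ j $ i)" for i j using assms unfolding hermitian_def by blast
  have "(A *v x) \<bullet> y = (\<Sum>i\<in>UNIV. \<Sum>j\<in>UNIV. (A $ i $ j * x $ j) \<bullet> (y $ i))"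
    by (simp add: inner_vec_def matrix_vector_mult_def inner_sum_left)
  also have "\<dots> = (\<Sum>j\<in>UNIV. \<Sum>i\<in>UNIV. (A $ i $ j * x $ j) \<bullet> (y $ i))"
    by (rule sum.swap)
  also have "\<dots> = (\<Sum>j\<in>UNIV. \<Sum>i\<in>UNIV. x $ j \<bullet> (A $ j $ i * y $ i))"
    by (intro sum.cong refl, subst herm) (simp add: inner_complex_def algebra_simps)
  also have "\<dots> = x \<bullet> (A *v y)"
    by (simp add: inner_vec_def matrix_vector_mult_def inner_sum_right)
  finally show ?thesis .
qed

lemma matrix_power_eigenvector:
  fixes A :: "complex^'k^'k"
  assumes "A *v v = (l::real) *\<^sub>R v"
  shows "matrix_power (c *\<^sub>R A + d *\<^sub>R mat 1) n *v v = ((c * l + d) ^ n) *\<^sub>R v"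
proof (induction n)
  case (Suc n)
  have scaleR: "(r *\<^sub>R M) *v v = r *\<^sub>R (M *v v)" for r :: real and M
    by (simp add: vec_eq_iff matrix_vector_mult_def scaleR_sum_right)
  have "(c *\<^sub>R A + d *\<^sub>R mat 1) *v v = (c * l + d) *\<^sub>R v"
    using assms by (simp add: matrix_vector_mult_add_rdistrib scaleR scaleR_left_distrib)
  then show ?case using Suc
    by (simp add: matrix_vector_mul_assoc[symmetric] linear_scale[OF matrix_vector_mul_linear] mult.commute)
qed simp

text \<open>\<open>E l\<close> is the spectral projection for \<open>l\<close>. Stating the affine family \<open>c A + d I\<close> with the same \<open>E\<close>
  lets \<open>x\<^sup>A\<^sup>-\<^sup>I\<close> and the functions of \<open>- t A\<close> share one decomposition.\<close>

definition spectral_decomposition ::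
    "complex^'k^'k \<Rightarrow> real set \<Rightarrow> (real \<Rightarrow> complex^'k^'k) \<Rightarrow> bool" where
  "spectral_decomposition A L E \<longleftrightarrow> finite L \<and>
     (\<forall>c d n. matrix_power (c *\<^sub>R A + d *\<^sub>R mat 1) n = (\<Sum>l\<in>L. ((c * l + d) ^ n) *\<^sub>R E l))"

text \<open>Column \<open>j\<close> of a matrix is its value at the basis vector
  \<open>axis j 1\<close>. Splitting that vector into eigenvectors \<open>w j l\<close> and
  collecting them as columns gives the projection \<open>E l\<close>.\<close>

lemma hermitian_spectral_decomposition:
  fixes A :: "complex^'k^'k"
  assumes "hermitian A"
  obtains L E where "spectral_decomposition A L E" "\<forall>l\<in>L. eigenvalue A (of_real l)"
proof -
  have "\<exists>L w. finite L \<and> axis j 1 = sum w L \<and> (\<forall>l. l \<notin> L \<longrightarrow> w l = 0) \<and> (\<forall>l. A *v w l = l *\<^sub>R w l)"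
    for j :: 'k
    using selfadjoint_eigenvector_decomposition[of "(*v) A" "axis j 1", OF _ hermitian_inner[OF assms]]
    by (metis matrix_vector_mul_linear)
  then obtain Lf w where w: "\<And>j. finite (Lf j)" "\<And>j. axis j 1 = sum (w j) (Lf j)"
    "\<And>j l. l \<notin> Lf j \<Longrightarrow> w j l = 0" "\<And>j l. A *v w j l = l *\<^sub>R w j l" by metis
  \<comment> \<open>Only values with a nonzero component are kept, so every member of
    \<open>L\<close> is a true eigenvalue.\<close>
  define L where "L = {l. \<exists>j. w j l \<noteq> 0}"
  have L_sub: "L \<subseteq> (\<Union>j. Lf j)" unfolding L_def using w(3) by auto
  have fin: "finite L" by (rule finite_subset[OF L_sub]) (auto simp: w)
  have ax: "axis j 1 = sum (w j) L" for j
    unfolding w(2) using fin w by (intro sum.mono_neutral_cong) (auto simp: L_def)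
  define E where "E = (\<lambda>l. \<chi> i j. w j l $ i)"
  have "eigenvalue A (of_real l)" if l: "l \<in> L" for l
  proof -
    obtain j where "w j l \<noteq> 0" using l unfolding L_def by auto
    moreover have "A *v w j l = of_real l *s w j l"
      unfolding w(4) by (simp add: vec_eq_iff scaleR_conv_of_real[where 'a = complex])
    ultimately show ?thesis unfolding eigenvalue_def by blast
  qed
  moreover have "matrix_power (c *\<^sub>R A + d *\<^sub>R mat 1) n = (\<Sum>l\<in>L. ((c * l + d) ^ n) *\<^sub>R E l)" for c d n
  proof -
    let ?M = "matrix_power (c *\<^sub>R A + d *\<^sub>R mat 1) n"
    have "?M $ i $ j = (\<Sum>l\<in>L. ((c * l + d) ^ n) *\<^sub>R E l) $ i $ j" for i j
    proof -
      have "?M $ i $ j = (?M *v axis j 1) $ i"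
        by (simp add: matrix_vector_mult_def axis_def if_distrib cong: if_cong)
      also have "?M *v axis j 1 = (\<Sum>l\<in>L. ?M *v w j l)"
        unfolding ax by (rule linear_sum[OF matrix_vector_mul_linear])
      also have "\<dots> = (\<Sum>l\<in>L. ((c * l + d) ^ n) *\<^sub>R w j l)"
        by (simp add: matrix_power_eigenvector[OF w(4)])
      finally show ?thesis by (simp add: E_def)
    qed
    then show ?thesis by (simp add: vec_eq_iff)
  qed
  ultimately show ?thesis
    using fin by (intro that[of L E]) (simp_all add: spectral_decomposition_def)
qed

text \<open>Functional calculus: convergence at the finitely many eigenvalues suffices. It serves
  both the exponential and the Mittag-Leffler series.\<close>

lemma matrix_power_series:
  fixes A :: "complex^'k^'k"
  assumes "\<And>n. matrix_power A n = (\<Sum>l\<in>L. (h l ^ n) *\<^sub>R E l)"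
    and "\<And>l. l \<in> L \<Longrightarrow> (\<lambda>n. k n * h l ^ n) sums g l"
  shows "(\<Sum>n. k n *\<^sub>R matrix_power A n) = (\<Sum>l\<in>L. (g l :: real) *\<^sub>R E l)"
proof (rule sums_unique[symmetric])
  have "(\<lambda>n. \<Sum>l\<in>L. (k n * h l ^ n) *\<^sub>R E l) sums (\<Sum>l\<in>L. g l *\<^sub>R E l)"
    by (intro sums_sum sums_scaleR_left assms)
  then show "(\<lambda>n. k n *\<^sub>R matrix_power A n) sums (\<Sum>l\<in>L. g l *\<^sub>R E l)"
    by (simp add: assms(1) scaleR_sum_right)
qed

section \<open>Powers with positive stable exponents\<close>

lemma pos_stable_hermitian_spectral_decomposition:
  fixes A :: "complex^'k^'k"
  assumes "A \<in> pos_stable_hermitian"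
  obtains L E where "spectral_decomposition A L E" "\<forall>l\<in>L. 0 < l"
proof -
  have "hermitian A" and pos: "\<And>l. eigenvalue A l \<Longrightarrow> 0 < Re l"
    using assms unfolding pos_stable_hermitian_def by auto
  obtain L E where "spectral_decomposition A L E" and eig: "\<forall>l\<in>L. eigenvalue A (of_real l)"
    by (rule hermitian_spectral_decomposition[OF \<open>hermitian A\<close>])
  moreover have "\<forall>l\<in>L. 0 < l" using pos eig by force
  ultimately show ?thesis by (intro that)
qed

lemma powr_matrix_spectral:
  fixes A :: "complex^'k^'k"
  assumes "spectral_decomposition A L E" "x > 0"
  shows "powr_matrix x (A + d *\<^sub>R mat 1) = (\<Sum>l\<in>L. (x powr (l + d)) *\<^sub>R E l)"
proof -
  have "ln x *\<^sub>R (A + d *\<^sub>R mat 1) = ln x *\<^sub>R A + (ln x * d) *\<^sub>R mat 1"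
    by (simp add: scaleR_right_distrib)
  then have "powr_matrix x (A + d *\<^sub>R mat 1)
      = (\<Sum>n. (1 / fact n) *\<^sub>R matrix_power (ln x *\<^sub>R A + (ln x * d) *\<^sub>R mat 1) n)"
    by (simp add: powr_matrix_def matrix_exp_def)
  also have "\<dots> = (\<Sum>l\<in>L. exp (ln x * l + ln x * d) *\<^sub>R E l)"
  proof (rule matrix_power_series)
    show "matrix_power (ln x *\<^sub>R A + (ln x * d) *\<^sub>R mat 1) n = (\<Sum>l\<in>L. (ln x * l + ln x * d) ^ n *\<^sub>R E l)" for n
      using assms(1) by (simp add: spectral_decomposition_def)
    fix l show "(\<lambda>n. 1 / fact n * (ln x * l + ln x * d) ^ n) sums exp (ln x * l + ln x * d)"
      using exp_converges[of "ln x * l + ln x * d"] by (simp add: divide_inverse mult.commute)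
  qed
  also have "\<dots> = (\<Sum>l\<in>L. (x powr (l + d)) *\<^sub>R E l)"
    using assms(2) by (simp add: powr_def algebra_simps)
  finally show ?thesis .
qed

text \<open>On the component of \<open>l\<close> the exponent \<open>l + n - 1\<close> splits as for
  scalars, which takes the place of the exponential law for commuting matrices.\<close>

lemma powr_matrix_shift:
  fixes A :: "complex^'k^'k"
  assumes "A \<in> pos_stable_hermitian" "x > 0"
  shows "powr_matrix x (A + real n *\<^sub>R mat 1 - mat 1) = x ^ n *\<^sub>R powr_matrix x (A - mat 1)"
proof -
  obtain L E where E: "spectral_decomposition A L E" and "\<forall>l\<in>L. 0 < l"
    by (rule pos_stable_hermitian_spectral_decomposition[OF assms(1)])
  have "A + real n *\<^sub>R mat 1 - mat 1 = A + (real n - 1) *\<^sub>R mat 1"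
    by (simp add: scaleR_left_diff_distrib)
  then have "powr_matrix x (A + real n *\<^sub>R mat 1 - mat 1) = (\<Sum>l\<in>L. (x powr (l + (real n - 1))) *\<^sub>R E l)"
    by (simp only: powr_matrix_spectral[OF E assms(2)])
  also have "\<dots> = x ^ n *\<^sub>R (\<Sum>l\<in>L. (x powr (l + - 1)) *\<^sub>R E l)"
  proof -
    have "x powr (real n + (l + - 1)) = x ^ n * x powr (l + - 1)" for l
      using assms(2) by (simp only: powr_add powr_realpow)
    moreover have "real n + (l + - 1) = l + (real n - 1)" for l by simp
    ultimately have "x powr (l + (real n - 1)) = x ^ n * x powr (l + - 1)" for l by metis
    then show ?thesis by (simp add: scaleR_sum_right)
  qed
  also have "\<dots> = x ^ n *\<^sub>R powr_matrix x (A - mat 1)"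
    using powr_matrix_spectral[OF E assms(2), of "-1"] by simp
  finally show ?thesis .
qed

subsection \<open>Integrals against high powers\<close>

lemma has_integral_reflect_unit_interval:
  fixes f :: "real \<Rightarrow> 'a::euclidean_space"
  assumes "(f has_integral i) {0..1}"
  shows "((\<lambda>x. f (1 - x)) has_integral i) {0..1}"
proof -
  have "(\<lambda>x. 1 - x) ` {0..1::real} = {0..1}"
    by (auto intro!: image_eqI[of _ _ "1 - x" for x])
  then show ?thesis
    using has_integral_affinity[of f i 0 1 "-1" 1] assms by simp
qed

text \<open>\<open>f\<close> may be only conditionally integrable, so dominated convergence is not available: the second
  mean value theorem on \<open>[0, b]\<close> and \<open>[b, 1]\<close> with \<open>b\<close> close to 1 replaces it.\<close>

lemma integral_power_tendsto_0_real:
  fixes f :: "real \<Rightarrow> real"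
  assumes f: "f integrable_on {0..1}"
  shows "(\<lambda>x. x ^ n * f x) integrable_on {0..1}"
    and "(\<lambda>n. integral {0..1} (\<lambda>x. x ^ n * f x)) \<longlonglongrightarrow> 0"
proof -
  have mono: "x ^ n \<le> y ^ n" if "0 \<le> x" "x \<le> y" for x y :: real and n
    using that by (rule power_mono[rotated])
  show int: "(\<lambda>x. x ^ n * f x) integrable_on {0..1}" for n
    by (rule second_mean_value_theorem_full[OF f, of "\<lambda>x. x ^ n"]) (auto intro: mono)
  have sub: "f integrable_on {c..d}" if "0 \<le> c" "d \<le> 1" for c d
    using integrable_on_subinterval[OF f] that by simp
  define H where "H = (\<lambda>c. integral {0..c} f)"
  have contH: "continuous_on {0..1} H"
    unfolding H_def using f by (rule indefinite_integral_continuous_1)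
  have H_diff: "integral {c..d} f = H d - H c" if "0 \<le> c" "c \<le> d" "d \<le> 1" for c d
    using Henstock_Kurzweil_Integration.integral_combine[of 0 c d f] that sub by (simp add: H_def)
  have "bounded (H ` {0..1})"
    using contH by (intro compact_imp_bounded compact_continuous_image) auto
  then obtain B where B: "B > 0" "\<And>c. c \<in> {0..1} \<Longrightarrow> \<bar>H c\<bar> \<le> B"
    unfolding bounded_pos by auto
  show "(\<lambda>n. integral {0..1} (\<lambda>x. x ^ n * f x)) \<longlonglongrightarrow> 0"
  proof (rule LIMSEQ_I)
    fix e :: real assume "e > 0"
    obtain d where "d > 0" and d: "\<And>c. c \<in> {0..1} \<Longrightarrow> dist c 1 < d \<Longrightarrow> dist (H c) (H 1) < e / 2"
      using contH[unfolded continuous_on_iff, rule_format, of 1 "e / 2"] \<open>e > 0\<close> by auto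
    \<comment> \<open>On \<open>[b, 1]\<close> the indefinite integral \<open>H\<close> stays within
      \<open>e / 2\<close> of \<open>H 1\<close>, uniformly in \<open>n\<close>; everything else
      carries the factor \<open>b ^ n\<close>. The bound 1/2 only keeps \<open>b\<close>
      positive.\<close>
    define b where "b = max (1/2) (1 - d / 2)"
    have b: "0 < b" "b < 1" "1 - b < d" using \<open>d > 0\<close> by (auto simp: b_def)
    have "(\<lambda>n. b ^ n * (5 * B)) \<longlonglongrightarrow> 0 * (5 * B)"
      by (intro tendsto_intros LIMSEQ_power_zero) (use b in auto)
    then have "\<forall>\<^sub>F n in sequentially. b ^ n * (5 * B) < e / 2"
      using \<open>e > 0\<close> by (intro order_tendstoD) auto
    then obtain N where N: "\<And>n. n \<ge> N \<Longrightarrow> b ^ n * (5 * B) < e / 2"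
      unfolding eventually_sequentially by auto
    have "norm (integral {0..1} (\<lambda>x. x ^ n * f x) - 0) < e" if n: "n \<ge> max N 1" for n
    proof -
      \<comment> \<open>This removes the left boundary term of the second mean value theorem and is
        why \<open>n \<ge> 1\<close> is required.\<close>
      have zero_pow: "0 ^ n = (0::real)" using n by simp
      obtain c where c: "c \<in> {0..b}" "integral {0..b} (\<lambda>x. x ^ n * f x)
          = 0 ^ n * integral {0..c} f + b ^ n * integral {c..b} f"
        using second_mean_value_theorem[of f 0 b "\<lambda>x. x ^ n"] mono sub[of 0 b] b by auto
      obtain c' where c': "c' \<in> {b..1}" "integral {b..1} (\<lambda>x. x ^ n * f x)
          = b ^ n * integral {b..c'} f + 1 ^ n * integral {c'..1} f"
        using second_mean_value_theorem[of f b 1 "\<lambda>x. x ^ n"] mono sub[of b 1] b by auto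
      have "integral {0..1} (\<lambda>x. x ^ n * f x)
          = integral {0..b} (\<lambda>x. x ^ n * f x) + integral {b..1} (\<lambda>x. x ^ n * f x)"
        using Henstock_Kurzweil_Integration.integral_combine[of 0 b 1 "\<lambda>x. x ^ n * f x"] int b by simp
      also have "\<dots> = b ^ n * (H b - H c + (H c' - H b)) + (H 1 - H c')"
        unfolding c(2) c'(2) zero_pow using c(1) c'(1) b by (simp add: H_diff algebra_simps)
      also have "\<bar>\<dots>\<bar> \<le> \<bar>b ^ n * (H b - H c + (H c' - H b))\<bar> + \<bar>H 1 - H c'\<bar>"
        by (rule abs_triangle_ineq)
      also have "\<bar>b ^ n * (H b - H c + (H c' - H b))\<bar> \<le> b ^ n * (5 * B)"
      proof -
        have "\<bar>H b - H c + (H c' - H b)\<bar> \<le> 5 * B"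
          using B(2)[of b] B(2)[of c] B(2)[of c'] B(1) b c c' by auto
        then show ?thesis using b by (simp add: abs_mult mult_left_mono)
      qed
      also have "b ^ n * (5 * B) + \<bar>H 1 - H c'\<bar> < e / 2 + e / 2"
        using N[of n] d[of c'] c' b n by (intro add_strict_mono) (auto simp: dist_real_def abs_minus_commute)
      finally show ?thesis by simp
    qed
    then show "\<exists>no. \<forall>n\<ge>no. norm (integral {0..1} (\<lambda>x. x ^ n * f x) - 0) < e" by blast
  qed
qed

lemma integral_power_tendsto_0:
  fixes f :: "real \<Rightarrow> 'a::euclidean_space"
  assumes f: "f integrable_on {0..1}"
  shows "(\<lambda>x. x ^ n *\<^sub>R f x) integrable_on {0..1}"
    and "(\<lambda>n. integral {0..1} (\<lambda>x. x ^ n *\<^sub>R f x)) \<longlonglongrightarrow> 0"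
proof -
  have fb: "(\<lambda>x. f x \<bullet> b) integrable_on {0..1}" if "b \<in> Basis" for b
    using f that integrable_component by blast
  show int: "(\<lambda>x. x ^ n *\<^sub>R f x) integrable_on {0..1}" for n
    using integral_power_tendsto_0_real(1)[OF fb] integrable_componentwise_iff[of "\<lambda>x. x ^ n *\<^sub>R f x"]
    by simp
  show "(\<lambda>n. integral {0..1} (\<lambda>x. x ^ n *\<^sub>R f x)) \<longlonglongrightarrow> 0"
  proof (subst tendsto_componentwise_iff, intro ballI)
    fix b :: 'a assume "b \<in> Basis"
    then show "(\<lambda>n. integral {0..1} (\<lambda>x. x ^ n *\<^sub>R f x) \<bullet> b) \<longlonglongrightarrow> 0 \<bullet> b"
      using integral_power_tendsto_0_real(2)[OF fb] int
      by (simp add: integral_component_eq[symmetric])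
  qed
qed

text \<open>The factor is \<open>x ^ n - x ^ Suc n\<close>, so the series telescopes and its
  remainder is an integral against a high power. \<open>g\<close> is prescribed on the open interval
  only, where the matrix powers obey their exponent laws; the endpoints form a null set.\<close>

lemma sums_integral_power:
  fixes f :: "real \<Rightarrow> 'a::euclidean_space"
  assumes f: "f integrable_on {0..1}"
    and g: "\<And>n x. 0 < x \<Longrightarrow> x < 1 \<Longrightarrow> g n x = ((1 - x) * x ^ n) *\<^sub>R f x"
  shows "(\<lambda>n. integral {0..1} (g n)) sums integral {0..1} f"
proof -
  note int = integral_power_tendsto_0(1)[OF f]
  have "integral {0..1} (g n)
      = integral {0..1} (\<lambda>x. x ^ n *\<^sub>R f x) - integral {0..1} (\<lambda>x. x ^ Suc n *\<^sub>R f x)" for n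
  proof -
    have "integral {0..1} (g n) = integral {0..1} (\<lambda>x. x ^ n *\<^sub>R f x - x ^ Suc n *\<^sub>R f x)"
    proof (rule integral_spike[of "{0, 1}"])
      fix x :: real assume "x \<in> {0..1} - {0, 1}"
      then show "x ^ n *\<^sub>R f x - x ^ Suc n *\<^sub>R f x = g n x"
        by (simp add: g scaleR_left_diff_distrib left_diff_distrib)
    qed auto
    then show ?thesis by (simp only: integral_diff[OF int int])
  qed
  then show ?thesis
    using telescope_sums'[OF integral_power_tendsto_0(2)[OF f]] by simp
qed

lemma sums_integral_power_reflected:
  fixes f :: "real \<Rightarrow> 'a::euclidean_space"
  assumes f: "f integrable_on {0..1}"
    and g: "\<And>n x. 0 < x \<Longrightarrow> x < 1 \<Longrightarrow> g n x = (x * (1 - x) ^ n) *\<^sub>R f x"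
  shows "(\<lambda>n. integral {0..1} (g n)) sums integral {0..1} f"
proof -
  \<comment> \<open>No integrability of \<open>h\<close> is assumed: if one side diverges so does
    the other, and both integrals have the default value 0.\<close>
  have refl: "integral {0..1} (\<lambda>x. h (1 - x)) = integral {0..1} h" for h :: "real \<Rightarrow> 'a"
  proof (cases "h integrable_on {0..1}")
    case True
    then show ?thesis
      using has_integral_reflect_unit_interval integrable_integral integral_unique by blast
  next
    case False
    moreover have "\<not> (\<lambda>x. h (1 - x)) integrable_on {0..1}"
      using False has_integral_reflect_unit_interval[of "\<lambda>x. h (1 - x)"]
      by (auto simp: integrable_on_def)
    ultimately show ?thesis by (simp add: not_integrable_integral)
  qed
  have "(\<lambda>x. f (1 - x)) integrable_on {0..1}"
    using f has_integral_reflect_unit_interval by (auto simp: integrable_on_def)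
  from sums_integral_power[OF this, of "\<lambda>n x. g n (1 - x)"] show ?thesis
    by (simp add: refl g)
qed

subsection \<open>The reciprocal Gamma function on vertical lines\<close>

lemma rGamma_pos: "x > 0 \<Longrightarrow> rGamma (x::real) > 0"
  by (simp add: rGamma_inverse_Gamma Gamma_real_pos)

text \<open>By Euler's product the quotient is \<open>lim (\<Prod>k\<le>n. \<bar>1 + \<i> y / (x + k)\<bar>)\<close>, and each factor
  decreases in \<open>x\<close>.\<close>

lemma norm_rGamma_quotient_antimono:
  fixes x u y :: real
  assumes "0 < u" "u \<le> x"
  shows "norm (rGamma (Complex x y)) / rGamma x \<le> norm (rGamma (Complex u y)) / rGamma u"
proof -
  define q where "q = (\<lambda>x n. norm (rGamma_series (Complex x y) n) / rGamma_series x n)"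
  have lim: "q x \<longlonglongrightarrow> norm (rGamma (Complex x y)) / rGamma x" if "x > 0" for x
    unfolding q_def using rGamma_pos[OF that]
    by (intro tendsto_intros rGamma_series_LIMSEQ) auto
  have q: "q x n = (\<Prod>k=0..n. norm (Complex x y + of_nat k) / (x + real k))" if "x > 0" for x n
  proof -
    \<comment> \<open>The factors \<open>n\<close> to the power \<open>x + \<i> y\<close> and
      \<open>n\<close> to the power \<open>x\<close> have equal modulus, so they cancel in
      \<open>q\<close> together with the factorials.\<close>
    have "norm (exp (Complex x y * of_real (ln (real n)))) = exp (x * ln (real n))"
      by (simp add: norm_exp_eq_Re)
    then have "norm (rGamma_series (Complex x y) n) = norm (pochhammer (Complex x y) (n+1)) / (fact n * exp (x * ln (real n)))"
      unfolding rGamma_series_def norm_divide norm_mult by simp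
    then show ?thesis using that
      by (simp add: q_def rGamma_series_def pochhammer_prod norm_mult prod_norm[symmetric] prod_dividef
          atLeast0LessThan lessThan_Suc_atMost atLeast0AtMost)
  qed
  have "q x n \<le> q u n" for n
  proof -
    have "norm (Complex x y + of_nat k) / (x + real k) \<le> norm (Complex u y + of_nat k) / (u + real k)" for k
    proof -
      have eq: "norm (Complex v y + of_nat k) / (v + real k) = sqrt (1 + (y / (v + real k))\<^sup>2)" if "v > 0" for v
      proof -
        have "norm (Complex v y + of_nat k) = sqrt ((v + real k)\<^sup>2 + y\<^sup>2)"
          by (simp add: cmod_def)
        also have "\<dots> / (v + real k) = sqrt (((v + real k)\<^sup>2 + y\<^sup>2) / (v + real k)\<^sup>2)"
          using that by (simp add: real_sqrt_divide)
        also have "((v + real k)\<^sup>2 + y\<^sup>2) / (v + real k)\<^sup>2 = 1 + (y / (v + real k))\<^sup>2"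
          using that by (simp add: power_divide add_divide_distrib)
        finally show ?thesis .
      qed
      have "\<bar>y / (x + real k)\<bar> \<le> \<bar>y / (u + real k)\<bar>"
        using assms by (simp add: frac_le)
      then have "(y / (x + real k))\<^sup>2 \<le> (y / (u + real k))\<^sup>2" by (simp only: abs_le_square_iff)
      then show ?thesis using assms by (simp add: eq)
    qed
    then show ?thesis using assms by (subst (1 2) q) (auto intro!: prod_mono)
  qed
  then show ?thesis using lim[of x] lim[of u] assms
    by (intro LIMSEQ_le[of "q x" _ "q u"]) auto
qed

text \<open>On the line \<open>Re z = 1/2\<close> one has \<open>1 - z = cnj z\<close>, so the
  reflection formula gives the squared modulus as \<open>\<bar>sin (\<pi> z)\<bar> / \<pi>\<close>.
  Antimonotonicity of the normalised modulus carries the bound to larger real parts.\<close>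

lemma norm_rGamma_le:
  fixes x y :: real
  assumes "x \<ge> 1/2"
  shows "norm (rGamma (Complex x y)) \<le> rGamma x * exp (pi * \<bar>y\<bar> / 2)"
proof -
  define c where "c = rGamma (1/2 :: real)"
  have c_pos: "c > 0" unfolding c_def by (rule rGamma_pos) simp
  have c2: "c\<^sup>2 = 1 / pi"
    unfolding c_def rGamma_inverse_Gamma Gamma_one_half_real power_inverse by (simp add: divide_inverse)
  define z where "z = Complex (1/2) y"
  have "1 - z = cnj z" by (simp add: z_def complex_eq_iff)
  then have "rGamma z * rGamma (cnj z) = sin (of_real pi * z) / of_real pi"
    using rGamma_reflection_complex[of z] by simp
  then have "norm (rGamma z * rGamma (cnj z)) = norm (sin (of_real pi * z)) / pi"
    by (simp add: norm_divide)
  moreover have "norm (rGamma (cnj z)) = norm (rGamma z)"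
    by (metis cnj_rGamma complex_mod_cnj)
  ultimately have "(norm (rGamma z))\<^sup>2 = norm (sin (of_real pi * z)) / pi"
    by (simp add: norm_mult power2_eq_square)
  also have "\<dots> \<le> exp (pi * \<bar>y\<bar>) / pi"
    using cmod_sin_le_exp[of 1 "of_real pi * z"] by (simp add: z_def divide_right_mono abs_mult)
  also have "\<dots> = (exp (pi * \<bar>y\<bar> / 2))\<^sup>2 * (1 / pi)"
    by (simp flip: exp_double)
  also have "\<dots> = (exp (pi * \<bar>y\<bar> / 2) * c)\<^sup>2"
    unfolding c2[symmetric] power_mult_distrib ..
  finally have "norm (rGamma z) \<le> exp (pi * \<bar>y\<bar> / 2) * c"
    by (rule power2_le_imp_le) (use c_pos in simp)
  then have "norm (rGamma z) / c \<le> exp (pi * \<bar>y\<bar> / 2)"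
    using c_pos by (simp only: divide_le_eq) simp
  moreover have "norm (rGamma (Complex x y)) / rGamma x \<le> norm (rGamma z) / c"
    unfolding c_def z_def by (rule norm_rGamma_quotient_antimono) (use assms in auto)
  ultimately have "norm (rGamma (Complex x y)) / rGamma x \<le> exp (pi * \<bar>y\<bar> / 2)" by linarith
  then show ?thesis using rGamma_pos[of x] assms by (simp add: divide_le_eq mult.commute)
qed

text \<open>Two steps of the Gamma recurrence reach real part \<open>x + 2 \<ge> 1\<close>, at the
  price of the factors \<open>z\<close> and \<open>z + 1\<close>. This covers the line
  \<open>Re s = -1/2\<close>, where \<open>\<phi> s + \<psi>\<close> may have negative real
  part.\<close>

lemma norm_rGamma_le_poly:
  fixes x y :: real
  assumes "x \<ge> -1"
  shows "norm (rGamma (Complex x y)) \<le> (\<bar>x\<bar> + \<bar>y\<bar> + 1)\<^sup>2 * rGamma (x + 2) * exp (pi * \<bar>y\<bar> / 2)"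
proof -
  let ?z = "Complex x y"
  have "rGamma ?z = ?z * (?z + 1) * rGamma (?z + 1 + 1)"
    using rGamma_plus1[of ?z] rGamma_plus1[of "?z + 1"] by (metis mult.assoc)
  also have "?z + 1 + 1 = Complex (x + 2) y" by (simp add: complex_eq_iff)
  finally have "norm (rGamma ?z) = norm ?z * norm (?z + 1) * norm (rGamma (Complex (x + 2) y))"
    by (simp add: norm_mult)
  also have "\<dots> \<le> (\<bar>x\<bar> + \<bar>y\<bar> + 1) * (\<bar>x\<bar> + \<bar>y\<bar> + 1) * (rGamma (x + 2) * exp (pi * \<bar>y\<bar> / 2))"
  proof (intro mult_mono norm_rGamma_le)
    show "norm ?z \<le> \<bar>x\<bar> + \<bar>y\<bar> + 1" using cmod_le[of ?z] by simp
    show "norm (?z + 1) \<le> \<bar>x\<bar> + \<bar>y\<bar> + 1" using cmod_le[of "?z + 1"] by simp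
  qed (use assms in auto)
  finally show ?thesis by (simp add: power2_eq_square mult.assoc)
qed

text \<open>Euler's integral for Gamma is bounded below by its part over \<open>[K, K + 1]\<close>.
  As \<open>K\<close> is free, the reciprocal decays faster than any geometric rate.\<close>

lemma rGamma_exponential_bound:
  fixes K x :: real
  assumes "K > 0" "x \<ge> 1"
  shows "rGamma x \<le> exp (K + 1) * K powr (1 - x)"
proof -
  have int: "(\<lambda>t. t powr (x - 1) / exp t) integrable_on {K..K+1}"
    using assms by (intro integrable_continuous_interval continuous_intros) auto
  have "integral {K..K+1} (\<lambda>t. t powr (x - 1) / exp t) \<le> integral {0..} (\<lambda>t. t powr (x - 1) / exp t)"
    using assms Gamma_integral_real[of x]
    by (intro integral_subset_le int) auto
  moreover have "integral {0..} (\<lambda>t. t powr (x - 1) / exp t) = Gamma x"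
    using Gamma_integral_real[of x] assms by (simp add: integral_unique)
  moreover have "integral {K..K+1} (\<lambda>t. K powr (x - 1) / exp (K + 1)) \<le> integral {K..K+1} (\<lambda>t. t powr (x - 1) / exp t)"
    using assms by (intro integral_le int) (auto intro!: frac_le powr_mono2)
  ultimately have "K powr (x - 1) / exp (K + 1) \<le> Gamma x" by simp
  then have "inverse (Gamma x) \<le> inverse (K powr (x - 1) / exp (K + 1))"
    using assms by (intro le_imp_inverse_le) auto
  also have "\<dots> = exp (K + 1) * K powr (1 - x)"
    using assms by (simp add: powr_diff field_simps)
  finally show ?thesis by (simp add: rGamma_inverse_Gamma)
qed

subsection \<open>Boundedness of the Mittag-Leffler function on the negative axis\<close>

definition mittag_leffler_real :: "real \<Rightarrow> real \<Rightarrow> real \<Rightarrow> real" where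
  "mittag_leffler_real \<phi> \<psi> t = (\<Sum>n. rGamma (\<phi> * real n + \<psi>) * t ^ n)"

lemma summable_mittag_leffler:
  fixes \<phi> \<psi> t :: real
  assumes "\<phi> > 0"
  shows "summable (\<lambda>n. rGamma (\<phi> * real n + \<psi>) * t ^ n)"
proof -
  \<comment> \<open>With \<open>K\<close> to the power \<open>\<phi>\<close> equal to
    \<open>T\<close>, the terms are eventually dominated by a multiple of
    \<open>(\<bar>t\<bar> / T) ^ n\<close>, and \<open>T\<close> makes this ratio at most
    1/2.\<close>
  define T where "T = 2 * (\<bar>t\<bar> + 1)"
  have T: "T > 0" by (simp add: T_def add_nonneg_pos)
  define K where "K = T powr (1 / \<phi>)"
  have K: "K > 0" using T by (simp add: K_def)
  have K_powr: "K powr - (\<phi> * real n) = (1 / T) ^ n" for n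
  proof -
    have "K powr - (\<phi> * real n) = T powr (- real n)"
      using assms by (simp add: K_def powr_powr)
    also have "\<dots> = (1 / T) ^ n"
      using T by (simp add: powr_minus powr_realpow power_one_over inverse_eq_divide)
    finally show ?thesis .
  qed
  have "\<forall>\<^sub>F n in sequentially. real n \<ge> (1 - \<psi>) / \<phi>"
    by (rule eventually_ge_at_top[THEN eventually_compose_filterlim, OF filterlim_real_sequentially])
  then have "\<forall>\<^sub>F n in sequentially. norm (rGamma (\<phi> * real n + \<psi>) * t ^ n)
      \<le> (exp (K + 1) * K powr (1 - \<psi>)) * (1 / 2) ^ n"
  proof eventually_elim
    case (elim n)
    have ge1: "\<phi> * real n + \<psi> \<ge> 1" using elim assms by (simp add: field_simps)
    have "norm (rGamma (\<phi> * real n + \<psi>) * t ^ n) = rGamma (\<phi> * real n + \<psi>) * \<bar>t\<bar> ^ n"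
      using rGamma_pos[of "\<phi> * real n + \<psi>"] ge1 by (simp add: abs_mult power_abs)
    also have "\<dots> \<le> (exp (K + 1) * K powr (1 - (\<phi> * real n + \<psi>))) * \<bar>t\<bar> ^ n"
      by (intro mult_right_mono rGamma_exponential_bound K ge1) auto
    also have "K powr (1 - (\<phi> * real n + \<psi>)) = K powr (1 - \<psi>) * (1 / T) ^ n"
      unfolding K_powr[symmetric] powr_add[symmetric] by (simp add: algebra_simps)
    also have "exp (K + 1) * (K powr (1 - \<psi>) * (1 / T) ^ n) * \<bar>t\<bar> ^ n
        = (exp (K + 1) * K powr (1 - \<psi>)) * (\<bar>t\<bar> / T) ^ n"
      by (simp add: power_divide)
    also have "\<dots> \<le> (exp (K + 1) * K powr (1 - \<psi>)) * (1 / 2) ^ n"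
      using T by (intro mult_left_mono power_mono) (auto simp: T_def divide_simps)
    finally show ?case .
  qed
  then show ?thesis
    by (rule summable_comparison_test_ev) (intro summable_mult summable_geometric, simp)
qed

lemma isCont_mittag_leffler_real:
  assumes "\<phi> > 0"
  shows "isCont (mittag_leffler_real \<phi> \<psi>) t"
  unfolding mittag_leffler_real_def
  by (rule isCont_powser_converges_everywhere[OF summable_mittag_leffler[OF assms]])

section \<open>The Mellin-Barnes kernel and its residues\<close>

definition mellin_kernel :: "real \<Rightarrow> real \<Rightarrow> real \<Rightarrow> complex \<Rightarrow> complex" where
  "mellin_kernel \<phi> \<psi> t s = exp (s * of_real (ln t)) * rGamma (of_real \<phi> * s + of_real \<psi>) / sin (of_real pi * s)"

lemma sin_pi_times_eq_0_iff: "sin (of_real pi * s) = 0 \<longleftrightarrow> (\<exists>n::int. s = of_int n)" for s :: complex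
proof -
  have "sin (of_real pi * s) = 0 \<longleftrightarrow> (\<exists>n::int. of_real pi * s = of_real (real_of_int n * pi))"
    by (rule sin_eq_0)
  also have "\<dots> \<longleftrightarrow> (\<exists>n::int. s = of_int n)"
    by (simp add: mult.commute[of _ "complex_of_real pi"])
  finally show ?thesis .
qed

text \<open>The sine has a simple zero at \<open>n\<close> with derivative
  \<open>\<pi> (-1) ^ n\<close>; this sign turns the numerator's \<open>t ^ n\<close> into
  \<open>(- t) ^ n\<close>.\<close>

lemma residue_mellin_kernel:
  assumes "\<phi> > 0" "\<psi> > 0" "t > 0"
  shows "residue (mellin_kernel \<phi> \<psi> t) (of_nat n)
    = of_real (rGamma (\<phi> * real n + \<psi>) * (- t) ^ n) / of_real pi"
proof -
  define g where "g = (\<lambda>s. exp (s * of_real (ln t)) * rGamma (of_real \<phi> * s + of_real \<psi> :: complex))"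
  have g_n: "g (of_nat n) = of_real (rGamma (\<phi> * real n + \<psi>) * t ^ n)"
  proof -
    have "exp (of_nat n * of_real (ln t) :: complex) = of_real (t ^ n)"
      using assms(3) by (simp add: exp_of_nat_mult exp_of_real)
    moreover have "of_real \<phi> * of_nat n + of_real \<psi> = (of_real (\<phi> * real n + \<psi>) :: complex)" by simp
    ultimately show ?thesis by (simp only: g_def rGamma_complex_of_real) simp
  qed
  have pos: "rGamma (\<phi> * real n + \<psi>) > 0" using assms by (intro rGamma_pos add_nonneg_pos) auto
  have cosn: "cos (of_real pi * of_nat n :: complex) = (-1) ^ n"
    using cos_npi_complex'[of n] by (simp add: mult.commute)
  have "residue (\<lambda>w. g w / sin (of_real pi * w)) (of_nat n) = g (of_nat n) / (of_real pi * (-1) ^ n)"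
  proof (rule residue_simple_pole_deriv[where s = UNIV])
    show "g holomorphic_on UNIV" unfolding g_def by (intro holomorphic_intros)
    show "((\<lambda>w. sin (of_real pi * w)) has_field_derivative of_real pi * (-1) ^ n) (at (of_nat n :: complex))"
      by (auto intro!: derivative_eq_intros simp: cosn)
    show "g (of_nat n) \<noteq> 0" using pos assms by (simp add: g_n)
    show "sin (of_real pi * of_nat n :: complex) = 0"
      unfolding sin_pi_times_eq_0_iff by (rule exI[of _ "int n"]) simp
  qed (auto intro!: holomorphic_intros)
  then have "residue (mellin_kernel \<phi> \<psi> t) (of_nat n) = g (of_nat n) / (of_real pi * (-1) ^ n)"
    by (simp add: mellin_kernel_def[abs_def] g_def)
  also have "\<dots> = of_real (rGamma (\<phi> * real n + \<psi>) * (- t) ^ n) / of_real pi"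
    unfolding g_n by (cases "even n") (simp_all add: divide_simps)
  finally show ?thesis .
qed

lemma mellin_kernel_holomorphic:
  assumes "\<And>n::int. of_int n \<notin> S"
  shows "mellin_kernel \<phi> \<psi> t holomorphic_on S"
  unfolding mellin_kernel_def[abs_def]
  by (intro holomorphic_intros) (use assms sin_pi_times_eq_0_iff in metis)

text \<open>The abscissae -1/2 and \<open>N + 1/2\<close> enclose exactly the poles 0 to
  \<open>N\<close>, each with winding number 1. The \<open>\<pi>\<close> of the residue theorem
  cancels the one in the residues.\<close>

lemma contour_integral_mellin_kernel:
  fixes N :: nat
  assumes "\<phi> > 0" "\<psi> > 0" "t > 0" "Y > 0"
  defines "a \<equiv> Complex (-1/2) (-Y)" and "b \<equiv> Complex (real N + 1/2) Y"
  shows "contour_integral (rectpath a b) (mellin_kernel \<phi> \<psi> t)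
    = 2 * \<i> * of_real (\<Sum>n\<le>N. rGamma (\<phi> * real n + \<psi>) * (- t) ^ n)"
proof -
  \<comment> \<open>A strip slightly wider than the rectangle, containing no further
    integer.\<close>
  define S where "S = {z::complex. -1 < Re z} \<inter> {z. Re z < real N + 1}"
  define pts where "pts = (of_nat :: nat \<Rightarrow> complex) ` {..N}"
  have ab: "Re a \<le> Re b" "Im a \<le> Im b" using assms by (auto simp: a_def b_def)
  have cbox_S: "cbox a b \<subseteq> S" by (auto simp: S_def a_def b_def in_cbox_complex_iff)
  have pts_box: "pts \<subseteq> box a b" using assms by (auto simp: pts_def a_def b_def in_box_complex_iff)
  have "contour_integral (rectpath a b) (mellin_kernel \<phi> \<psi> t) =
      2 * pi * \<i> * (\<Sum>p\<in>pts. winding_number (rectpath a b) p * residue (mellin_kernel \<phi> \<psi> t) p)"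
  proof (rule Residue_theorem)
    show "open S" unfolding S_def by (intro open_Int open_halfspace_Re_gt open_halfspace_Re_lt)
    show "connected S" unfolding S_def
      by (intro convex_connected convex_Int convex_halfspace_Re_gt convex_halfspace_Re_lt)
    show "finite pts" by (simp add: pts_def)
    show "mellin_kernel \<phi> \<psi> t holomorphic_on S - pts"
    proof (rule mellin_kernel_holomorphic)
      fix n :: int
      show "of_int n \<notin> S - pts"
      proof
        assume n: "of_int n \<in> S - pts"
        then have "0 \<le> n" "n \<le> int N" by (auto simp: S_def)
        then have "(of_int n :: complex) = of_nat (nat n)" "nat n \<le> N" by auto
        then show False using n by (auto simp: pts_def)
      qed
    qed
    show "path_image (rectpath a b) \<subseteq> S - pts"
      using cbox_S pts_box path_image_rectpath_cbox_minus_box[OF ab] by auto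
    show "\<forall>z. z \<notin> S \<longrightarrow> winding_number (rectpath a b) z = 0"
      using winding_number_rectpath_outside[OF ab] cbox_S by auto
  qed auto
  also have "(\<Sum>p\<in>pts. winding_number (rectpath a b) p * residue (mellin_kernel \<phi> \<psi> t) p)
      = (\<Sum>p\<in>pts. residue (mellin_kernel \<phi> \<psi> t) p)"
    using pts_box by (intro sum.cong refl) (auto simp: winding_number_rectpath)
  also have "\<dots> = (\<Sum>n\<le>N. residue (mellin_kernel \<phi> \<psi> t) (of_nat n))"
    unfolding pts_def by (subst sum.reindex) (auto simp: inj_on_def)
  also have "\<dots> = of_real (\<Sum>n\<le>N. rGamma (\<phi> * real n + \<psi>) * (- t) ^ n) / of_real pi"
    unfolding residue_mellin_kernel[OF assms(1-3)] by (simp add: sum_divide_distrib)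
  finally show ?thesis by simp
qed

section \<open>Bounds for the kernel and its contour integrals\<close>

lemma norm_sin_pi_ge:
  assumes "cos (2 * pi * u) = -1 \<or> \<bar>y\<bar> \<ge> 1"
  shows "norm (sin (of_real pi * Complex u y)) \<ge> exp (pi * \<bar>y\<bar>) / 4"
proof -
  define X where "X = exp (2 * pi * \<bar>y\<bar>)"
  have X1: "X \<ge> 1" by (simp add: X_def)
  have "X + inverse X = exp (2 * (pi * y)) + inverse (exp (2 * (pi * y)))"
    by (cases "y \<ge> 0") (simp_all add: X_def exp_minus mult.assoc)
  then have sq: "(norm (sin (of_real pi * Complex u y)))\<^sup>2 = (X + inverse X - 2 * cos (2 * pi * u)) / 4"
    by (simp add: norm_sin_squared mult.assoc)
  \<comment> \<open>If the cosine is -1 it only helps. Otherwise \<open>X \<ge> 7\<close> absorbs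
    the loss of at most 2.\<close>
  have "X / 16 \<le> (X + inverse X - 2 * cos (2 * pi * u)) / 4"
    using assms
  proof
    assume "cos (2 * pi * u) = -1"
    then show ?thesis using X1 by simp
  next
    assume y: "\<bar>y\<bar> \<ge> 1"
    have "2 * pi * \<bar>y\<bar> \<ge> 2 * 3 * 1" using y pi_gt3 by (intro mult_mono) auto
    then have "X \<ge> 7" using exp_ge_add_one_self[of "2 * pi * \<bar>y\<bar>"] unfolding X_def by linarith
    moreover have "x / 16 \<le> (x + i - 2 * c) / 4" if "7 \<le> x" "0 \<le> i" "c \<le> 1" for x i c :: real
      using that by simp
    moreover have "inverse X \<ge> 0" using X1 by simp
    ultimately show ?thesis using cos_le_one by blast
  qed
  also have "X / 16 = (exp (pi * \<bar>y\<bar>) / 4)\<^sup>2"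
    by (simp add: X_def power_divide exp_double[symmetric] mult.assoc)
  finally show ?thesis unfolding sq[symmetric] by (rule power2_le_imp_le) simp
qed

text \<open>Four powers of \<open>1 + \<bar>y\<bar>\<close> have to be absorbed: two from the Gamma
  estimate and two to leave a majorant whose integral is an arctangent.\<close>

lemma exponential_beats_quartic:
  fixes d :: real
  assumes "d > 0"
  obtains C where "C > 0" "\<And>y. (1 + \<bar>y\<bar>)\<^sup>2 * exp (- d * \<bar>y\<bar>) \<le> C / (1 + y\<^sup>2)"
proof -
  \<comment> \<open>These bounds give
    \<open>1 + \<bar>y\<bar> \<le> m (1 + d \<bar>y\<bar> / 4)\<close>, and the fourth power of
    \<open>exp (d \<bar>y\<bar> / 4)\<close> is the exponential to be cancelled.\<close>
  define m where "m = max 1 (4 / d)"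
  have m: "m \<ge> 1" "m * d \<ge> 4" using assms by (auto simp: m_def max_def field_simps)
  have "(1 + \<bar>y\<bar>)\<^sup>2 * exp (- d * \<bar>y\<bar>) \<le> m ^ 4 / (1 + y\<^sup>2)" for y
  proof -
    have "4 * \<bar>y\<bar> \<le> m * d * \<bar>y\<bar>" using m by (intro mult_right_mono) auto
    then have "1 + \<bar>y\<bar> \<le> m * (1 + d * \<bar>y\<bar> / 4)" using m by (simp add: algebra_simps)
    also have "\<dots> \<le> m * exp (d * \<bar>y\<bar> / 4)" using m by (intro mult_left_mono exp_ge_add_one_self) auto
    finally have "(1 + \<bar>y\<bar>) ^ 4 \<le> (m * exp (d * \<bar>y\<bar> / 4)) ^ 4" by (intro power_mono) auto
    also have "\<dots> = m ^ 4 * exp (d * \<bar>y\<bar>)"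
      by (simp add: power_mult_distrib exp_of_nat_mult[symmetric])
    finally have "(1 + \<bar>y\<bar>) ^ 4 * exp (- d * \<bar>y\<bar>) \<le> m ^ 4 * exp (d * \<bar>y\<bar>) * exp (- d * \<bar>y\<bar>)"
      by (intro mult_right_mono) auto
    then have le: "(1 + \<bar>y\<bar>) ^ 4 * exp (- d * \<bar>y\<bar>) \<le> m ^ 4"
      by (simp add: mult.assoc flip: exp_add)
    have "1 + y\<^sup>2 \<le> (1 + \<bar>y\<bar>)\<^sup>2" by (simp add: power2_sum)
    then have "(1 + \<bar>y\<bar>)\<^sup>2 * exp (- d * \<bar>y\<bar>) * (1 + y\<^sup>2) \<le> (1 + \<bar>y\<bar>)\<^sup>2 * exp (- d * \<bar>y\<bar>) * (1 + \<bar>y\<bar>)\<^sup>2"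
      by (intro mult_left_mono) auto
    also have "\<dots> = (1 + \<bar>y\<bar>) ^ 4 * exp (- d * \<bar>y\<bar>)" by (simp add: power4_eq_xxxx power2_eq_square)
    also note le
    finally show ?thesis by (simp add: pos_le_divide_eq add_pos_nonneg)
  qed
  then show ?thesis using that[of "m ^ 4"] m by simp
qed

text \<open>Gamma growth against the sine leaves \<open>exp (- d \<bar>y\<bar>)\<close> with
  \<open>d = \<pi> (1 - \<phi> / 2) > 0\<close>. The constant \<open>C\<close> depends on
  \<open>\<phi>\<close> alone, and \<open>M\<close> is a parameter because the left, right and
  horizontal sides use different Gamma bounds.\<close>

lemma norm_mellin_kernel_le:
  assumes "\<phi> < 2"
  obtains C where "C > 0"
    "\<And>\<psi> t u y M. t > 0 \<Longrightarrow> cos (2 * pi * u) = -1 \<or> \<bar>y\<bar> \<ge> 1 \<Longrightarrow> M \<ge> 0 \<Longrightarrow>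
       norm (rGamma (Complex (\<phi> * u + \<psi>) (\<phi> * y))) \<le> M * (1 + \<bar>y\<bar>)\<^sup>2 * exp (pi * \<phi> * \<bar>y\<bar> / 2) \<Longrightarrow>
       norm (mellin_kernel \<phi> \<psi> t (Complex u y)) \<le> t powr u * M * C / (1 + y\<^sup>2)"
proof -
  define d where "d = pi * (1 - \<phi> / 2)"
  have "d > 0" using assms by (simp add: d_def)
  then obtain C where C: "C > 0" "\<And>y. (1 + \<bar>y\<bar>)\<^sup>2 * exp (- d * \<bar>y\<bar>) \<le> C / (1 + y\<^sup>2)"
    by (rule exponential_beats_quartic) blast
  show ?thesis
  proof (rule that[of "4 * C"])
    show "4 * C > 0" using C by simp
    fix \<psi> t u y M :: real
    assume t: "t > 0" and uy: "cos (2 * pi * u) = -1 \<or> \<bar>y\<bar> \<ge> 1" and M: "M \<ge> 0"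
      and G: "norm (rGamma (Complex (\<phi> * u + \<psi>) (\<phi> * y))) \<le> M * (1 + \<bar>y\<bar>)\<^sup>2 * exp (pi * \<phi> * \<bar>y\<bar> / 2)"
    have arg: "of_real \<phi> * Complex u y + of_real \<psi> = Complex (\<phi> * u + \<psi>) (\<phi> * y)"
      by (simp add: complex_eq_iff)
    have t_u: "norm (exp (Complex u y * of_real (ln t))) = t powr u"
      using t by (simp add: norm_exp_eq_Re powr_def)
    have "norm (mellin_kernel \<phi> \<psi> t (Complex u y)) = t powr u *
        (norm (rGamma (Complex (\<phi> * u + \<psi>) (\<phi> * y))) / norm (sin (of_real pi * Complex u y)))"
      unfolding mellin_kernel_def arg norm_divide norm_mult t_u by simp
    also have "\<dots> \<le> t powr u * (M * (1 + \<bar>y\<bar>)\<^sup>2 * exp (pi * \<phi> * \<bar>y\<bar> / 2) / (exp (pi * \<bar>y\<bar>) / 4))"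
      using M by (intro mult_left_mono frac_le G norm_sin_pi_ge uy) auto
    also have "\<dots> = t powr u * M * 4 * ((1 + \<bar>y\<bar>)\<^sup>2 * (exp (pi * \<phi> * \<bar>y\<bar> / 2) / exp (pi * \<bar>y\<bar>)))"
      by simp
    also have "exp (pi * \<phi> * \<bar>y\<bar> / 2) / exp (pi * \<bar>y\<bar>) = exp (- d * \<bar>y\<bar>)"
      by (simp add: exp_diff[symmetric] d_def algebra_simps)
    also have "t powr u * M * 4 * ((1 + \<bar>y\<bar>)\<^sup>2 * exp (- d * \<bar>y\<bar>)) \<le> t powr u * M * 4 * (C / (1 + y\<^sup>2))"
      using M by (intro mult_left_mono C) auto
    finally show "norm (mellin_kernel \<phi> \<psi> t (Complex u y)) \<le> t powr u * M * (4 * C) / (1 + y\<^sup>2)"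
      by (simp add: mult_ac)
  qed
qed

text \<open>The majorant integrates to \<open>2 B arctan Y\<close>, which is bounded independently
  of the height \<open>Y\<close>.\<close>

lemma norm_contour_integral_vertical_le:
  fixes f :: "complex \<Rightarrow> complex"
  assumes "Y > 0" and cont: "continuous_on {z. Re z = u} f"
    and bound: "\<And>y. norm (f (Complex u y)) \<le> B / (1 + y\<^sup>2)" and "B \<ge> 0"
  shows "norm (contour_integral (linepath (Complex u (-Y)) (Complex u Y)) f) \<le> B * pi"
proof -
  have "((\<lambda>y. B / (1 + y\<^sup>2)) has_integral B * arctan Y - B * arctan (-Y)) {-Y..Y}"
    using assms(1)
    by (intro fundamental_theorem_of_calculus)
       (auto intro!: derivative_eq_intros simp: has_real_derivative_iff_has_vector_derivative[symmetric] inverse_eq_divide)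
  moreover have "(\<lambda>y. f (Complex u y)) integrable_on {-Y..Y}"
    by (intro integrable_continuous_interval continuous_on_compose2[OF cont])
       (auto intro!: continuous_intros simp: Complex_eq)
  ultimately have "norm (integral {-Y..Y} (\<lambda>y. f (Complex u y))) \<le> B * arctan Y - B * arctan (-Y)"
    using bound by (metis (mono_tags, lifting) has_integral_integrable integral_norm_bound_integral integral_unique)
  also have "\<dots> = B * (2 * arctan Y)" by (simp add: arctan_minus)
  also have "\<dots> \<le> B * pi" using assms arctan_ubound[of Y] by (intro mult_left_mono) auto
  finally show ?thesis
    using assms by (subst contour_integral_linepath_same_Re[of _ u _ "-Y" Y]) (auto simp: norm_mult)
qed

text \<open>Only the horizontal sides see \<open>Y\<close>, through \<open>H\<close>, which tends to
  0 in the application. Continuity is asked only on the lines carrying the sides, since the kernel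
  has poles inside.\<close>

lemma norm_contour_integral_rectpath_le:
  fixes f :: "complex \<Rightarrow> complex"
  assumes "u < v" "Y > 0"
    and cont: "\<And>S. (\<And>s. s \<in> S \<Longrightarrow> Re s = u \<or> Re s = v \<or> \<bar>Im s\<bar> = Y) \<Longrightarrow> continuous_on S f"
    and left: "\<And>y. norm (f (Complex u y)) \<le> A / (1 + y\<^sup>2)" and "A \<ge> 0"
    and right: "\<And>y. norm (f (Complex v y)) \<le> B / (1 + y\<^sup>2)" and "B \<ge> 0"
    and horizontal: "\<And>x y. x \<in> {u..v} \<Longrightarrow> \<bar>y\<bar> = Y \<Longrightarrow> norm (f (Complex x y)) \<le> H"
  shows "norm (contour_integral (rectpath (Complex u (-Y)) (Complex v Y)) f)
    \<le> A * pi + B * pi + 2 * H * (v - u)"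
proof -
  let ?a = "Complex u (-Y)" and ?b = "Complex v (-Y)" and ?c = "Complex v Y" and ?d = "Complex u Y"
  let ?I = "\<lambda>p q. contour_integral (linepath p q) f"
  have seg: "s \<in> closed_segment p q \<Longrightarrow> Re p = Re q \<Longrightarrow> Re s = Re p"
            "s \<in> closed_segment p q \<Longrightarrow> Im p = Im q \<Longrightarrow> Im s = Im p" for s p q
    by (auto simp: closed_segment_def left_diff_distrib)
  have int: "f contour_integrable_on linepath p q"
    if "Re p = Re q \<and> Re p \<in> {u, v} \<or> Im p = Im q \<and> \<bar>Im p\<bar> = Y" for p q
    by (intro contour_integrable_continuous_linepath cont) (use seg that in fastforce)
  have H0: "H \<ge> 0" using horizontal[of u Y] assms(1,2) by (smt (verit) atLeastAtMost_iff norm_ge_zero)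
  have hor: "norm (?I p q) \<le> H * (v - u)"
    if "Im p = Im q" "\<bar>Im p\<bar> = Y" "{Re p, Re q} = {u, v}" for p q
  proof -
    have "norm (?I p q) \<le> H * norm (q - p)"
    proof (rule contour_integral_bound_linepath)
      show "f contour_integrable_on linepath p q" using int that by auto
      fix s assume s: "s \<in> closed_segment p q"
      have "closed_segment p q \<subseteq> {s. u \<le> Re s} \<inter> {s. Re s \<le> v}"
        using that assms(1)
        by (intro closed_segment_subset convex_Int convex_halfspace_Re_ge convex_halfspace_Re_le)
           (auto simp: doubleton_eq_iff)
      then have "Re s \<in> {u..v}" using s by auto
      then have "norm (f (Complex (Re s) (Im s))) \<le> H"
        using seg(2)[OF s] that by (intro horizontal) auto
      then show "norm (f s) \<le> H" by simp
    qed (rule H0)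
    moreover have "norm (q - p) = v - u"
      using that assms(1) by (auto simp: doubleton_eq_iff cmod_eq_Re)
    ultimately show ?thesis by simp
  qed
  have "contour_integral (rectpath ?a ?c) f = ?I ?a ?b + (?I ?b ?c + (?I ?c ?d + ?I ?d ?a))"
    using assms(2)
    by (simp add: rectpath_def Let_def contour_integral_join valid_path_join contour_integrable_joinI int)
  also have "?I ?d ?a = - ?I ?a ?d" by (rule contour_integral_reverse_linepath)
    (intro cont, use seg in fastforce)
  finally have eq: "contour_integral (rectpath ?a ?c) f = ?I ?a ?b + (?I ?b ?c + (?I ?c ?d + - ?I ?a ?d))" .
  have "norm (?I ?a ?b) \<le> H * (v - u)" "norm (?I ?c ?d) \<le> H * (v - u)"
    using assms(2) by (intro hor; auto)+
  moreover have "norm (?I ?b ?c) \<le> B * pi"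
    by (intro norm_contour_integral_vertical_le cont right assms) auto
  moreover have "norm (?I ?a ?d) \<le> A * pi"
    by (intro norm_contour_integral_vertical_le cont left assms) auto
  moreover have "norm (contour_integral (rectpath ?a ?c) f)
      \<le> norm (?I ?a ?b) + (norm (?I ?b ?c) + (norm (?I ?c ?d) + norm (?I ?a ?d)))"
    unfolding eq by (intro order_trans[OF norm_triangle_ineq] add_mono order_refl) simp
  ultimately show ?thesis by (simp add: algebra_simps)
qed

text \<open>\<open>A\<close> comes from the left side, where \<open>t powr (-1/2) \<le> 1\<close>.
  The right side gives \<open>t powr (1/2)\<close> times a term of the Mittag-Leffler series with
  \<open>\<psi> + \<phi> / 2\<close> for \<open>\<psi>\<close>, which tends to 0 as \<open>N\<close>
  grows. Neither constant depends on \<open>t\<close> or \<open>N\<close>.\<close>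

lemma abs_mittag_leffler_partial_sum_le:
  assumes "0 < \<phi>" "\<phi> < 2" "\<psi> > 0"
  obtains A B where "A \<ge> 0" "B \<ge> 0"
    "\<And>t N. t \<ge> 1 \<Longrightarrow> 1/2 \<le> \<phi> * real N \<Longrightarrow>
      \<bar>\<Sum>n\<le>N. rGamma (\<phi> * real n + \<psi>) * (- t) ^ n\<bar>
        \<le> A + B * t powr (1/2) * (rGamma (\<phi> * real N + (\<phi> / 2 + \<psi>)) * t ^ N)"
proof -
  obtain C where C: "C > 0" "\<And>\<psi> t u y M. t > 0 \<Longrightarrow> cos (2 * pi * u) = -1 \<or> \<bar>y\<bar> \<ge> 1 \<Longrightarrow> M \<ge> 0 \<Longrightarrow>
       norm (rGamma (Complex (\<phi> * u + \<psi>) (\<phi> * y))) \<le> M * (1 + \<bar>y\<bar>)\<^sup>2 * exp (pi * \<phi> * \<bar>y\<bar> / 2) \<Longrightarrow>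
       norm (mellin_kernel \<phi> \<psi> t (Complex u y)) \<le> t powr u * M * C / (1 + y\<^sup>2)"
    by (rule norm_mellin_kernel_le[OF assms(2)]) blast
  \<comment> \<open>The coefficient left by \<open>norm_rGamma_le_poly\<close> once
    \<open>(1 + \<bar>y\<bar>)\<^sup>2\<close> is split off; it serves the left and horizontal
    sides.\<close>
  define m where "m = (\<lambda>u. (\<bar>\<phi> * u + \<psi>\<bar> + \<phi> + 1)\<^sup>2 * rGamma (\<phi> * u + \<psi> + 2))"
  have ge_m1: "\<phi> * u + \<psi> \<ge> -1" if "u \<ge> -1/2" for u
  proof -
    have "\<phi> * (-1/2) \<le> \<phi> * u" using that assms(1) by (intro mult_left_mono) auto
    then show ?thesis using assms by linarith
  qed
  have m0: "m u \<ge> 0" if "u \<ge> -1/2" for u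
    using ge_m1[OF that] rGamma_pos[of "\<phi> * u + \<psi> + 2"] by (simp add: m_def)
  have m: "norm (rGamma (Complex (\<phi> * u + \<psi>) (\<phi> * y))) \<le> m u * (1 + \<bar>y\<bar>)\<^sup>2 * exp (pi * \<phi> * \<bar>y\<bar> / 2)"
    if "u \<ge> -1/2" for u y
  proof -
    let ?x = "\<phi> * u + \<psi>"
    have "norm (rGamma (Complex ?x (\<phi> * y))) \<le> (\<bar>?x\<bar> + \<bar>\<phi> * y\<bar> + 1)\<^sup>2 * rGamma (?x + 2) * exp (pi * \<bar>\<phi> * y\<bar> / 2)"
      by (rule norm_rGamma_le_poly[OF ge_m1[OF that]])
    also have "\<dots> \<le> ((\<bar>?x\<bar> + \<phi> + 1) * (1 + \<bar>y\<bar>))\<^sup>2 * rGamma (?x + 2) * exp (pi * \<bar>\<phi> * y\<bar> / 2)"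
    proof (intro mult_right_mono power_mono)
      show "\<bar>?x\<bar> + \<bar>\<phi> * y\<bar> + 1 \<le> (\<bar>?x\<bar> + \<phi> + 1) * (1 + \<bar>y\<bar>)"
        using assms(1) by (simp add: algebra_simps abs_mult)
      show "0 \<le> rGamma (?x + 2)" using ge_m1[OF that] rGamma_pos[of "?x + 2"] by simp
    qed auto
    also have "\<dots> = m u * (1 + \<bar>y\<bar>)\<^sup>2 * exp (pi * \<phi> * \<bar>y\<bar> / 2)"
      using assms(1) by (simp add: m_def power_mult_distrib abs_mult mult_ac)
    finally show ?thesis .
  qed
  \<comment> \<open>For the right side the coefficient must be \<open>rGamma\<close> itself, so that
    it decays with \<open>N\<close>. The condition \<open>1/2 \<le> \<phi> * real N\<close> places
    that side in the range of this bound.\<close>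
  have rG: "norm (rGamma (Complex (\<phi> * u + \<psi>) (\<phi> * y)))
      \<le> rGamma (\<phi> * u + \<psi>) * (1 + \<bar>y\<bar>)\<^sup>2 * exp (pi * \<phi> * \<bar>y\<bar> / 2)"
    if "\<phi> * u + \<psi> \<ge> 1/2" for u y
  proof -
    have "norm (rGamma (Complex (\<phi> * u + \<psi>) (\<phi> * y))) \<le> rGamma (\<phi> * u + \<psi>) * 1 * exp (pi * \<bar>\<phi> * y\<bar> / 2)"
      using norm_rGamma_le[OF that] by simp
    also have "\<dots> \<le> rGamma (\<phi> * u + \<psi>) * (1 + \<bar>y\<bar>)\<^sup>2 * exp (pi * \<bar>\<phi> * y\<bar> / 2)"
      using that rGamma_pos[of "\<phi> * u + \<psi>"] by (intro mult_right_mono mult_left_mono) (auto intro: one_le_power)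
    finally show ?thesis using assms(1) by (simp add: abs_mult mult_ac)
  qed
  have main: "\<bar>\<Sum>n\<le>N. rGamma (\<phi> * real n + \<psi>) * (- t) ^ n\<bar>
        \<le> m (-1/2) * C * pi / 2 + C * pi / 2 * t powr (1/2) * (rGamma (\<phi> * real N + (\<phi> / 2 + \<psi>)) * t ^ N)"
    if t: "t \<ge> 1" and N: "1/2 \<le> \<phi> * real N" for t N
  proof -
    define v where "v = real N + 1/2"
    define S where "S = (\<Sum>n\<le>N. rGamma (\<phi> * real n + \<psi>) * (- t) ^ n)"
    define r where "r = rGamma (\<phi> * v + \<psi>)"
    have v: "\<phi> * v + \<psi> \<ge> 1/2" "v \<ge> 1/2"
      using N assms by (auto simp: v_def algebra_simps intro: order_trans)
    have r: "r \<ge> 0" using rGamma_pos[of "\<phi> * v + \<psi>"] v unfolding r_def by linarith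
    \<comment> \<open>\<open>M\<close> may depend on \<open>N\<close>: it enters only the horizontal
      sides, which vanish as \<open>Y\<close> grows with \<open>N\<close> fixed.\<close>
    have "continuous_on {-1/2..v} m"
      unfolding m_def
      by (intro continuous_intros continuous_on_compose2[OF continuous_on_rGamma[of UNIV]]) auto
    then have "bounded (m ` {-1/2..v})"
      by (intro compact_imp_bounded compact_continuous_image) auto
    then obtain M where M: "M > 0" "\<And>u. u \<in> {-1/2..v} \<Longrightarrow> \<bar>m u\<bar> \<le> M"
      unfolding bounded_pos by auto
    have bound: "2 * \<bar>S\<bar> \<le> m (-1/2) * C * pi + t powr v * r * C * pi + 2 * (t powr v * M * C / (1 + Y\<^sup>2)) * (v - -1/2)"
      if Y: "Y \<ge> 1" for Y
    proof -
      \<comment> \<open>On both vertical sides the sine estimate thus holds at every height; on the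
        horizontal ones it holds because \<open>Y \<ge> 1\<close>.\<close>
      have cos1: "cos (2 * pi * (-1/2)) = -1" by simp
      have "2 * pi * v = real (2 * N + 1) * pi" by (simp add: v_def algebra_simps)
      then have cosv: "cos (2 * pi * v) = -1" by (simp only: cos_npi) simp
      have "norm (contour_integral (rectpath (Complex (-1/2) (-Y)) (Complex v Y)) (mellin_kernel \<phi> \<psi> t))
        \<le> (m (-1/2) * C) * pi + (t powr v * r * C) * pi + 2 * (t powr v * M * C / (1 + Y\<^sup>2)) * (v - -1/2)"
      proof (rule norm_contour_integral_rectpath_le)
        show "continuous_on S (mellin_kernel \<phi> \<psi> t)"
          if S: "\<And>s. s \<in> S \<Longrightarrow> Re s = -1/2 \<or> Re s = v \<or> \<bar>Im s\<bar> = Y" for S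
        proof (rule holomorphic_on_imp_continuous_on[OF mellin_kernel_holomorphic])
          fix n :: int
          have half: "real_of_int n \<noteq> real_of_int k + 1/2" for k
          proof
            assume "real_of_int n = real_of_int k + 1/2"
            then have "real_of_int (2 * n) = real_of_int (2 * k + 1)" by simp
            then have "2 * n = 2 * k + 1" by (simp only: of_int_eq_iff)
            then show False by presburger
          qed
          have "real_of_int n \<noteq> -1/2" "real_of_int n \<noteq> v"
            using half[of "-1"] half[of "int N"] by (simp_all add: v_def)
          then show "of_int n \<notin> S" using S[of "of_int n"] Y by auto
        qed
      next
        fix y
        have "norm (mellin_kernel \<phi> \<psi> t (Complex (-1/2) y)) \<le> t powr (-1/2) * m (-1/2) * C / (1 + y\<^sup>2)"
          by (rule C(2)[OF _ _ m0 m]) (use t cos1 in auto)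
        also have "\<dots> \<le> 1 * m (-1/2) * C / (1 + y\<^sup>2)"
          using t m0 C powr_mono[of "-1/2" 0 t]
          by (intro divide_right_mono mult_right_mono) (auto simp: add_nonneg_nonneg)
        finally show "norm (mellin_kernel \<phi> \<psi> t (Complex (-1/2) y)) \<le> m (-1/2) * C / (1 + y\<^sup>2)" by simp
        show "norm (mellin_kernel \<phi> \<psi> t (Complex v y)) \<le> t powr v * r * C / (1 + y\<^sup>2)"
          by (rule C(2)[OF _ _ r]) (use t cosv rG[of v] v in \<open>auto simp: r_def\<close>)
      next
        fix x y assume x: "x \<in> {-1/2..v}" and y: "\<bar>y\<bar> = Y"
        have "norm (mellin_kernel \<phi> \<psi> t (Complex x y)) \<le> t powr x * m x * C / (1 + y\<^sup>2)"
          by (rule C(2)[OF _ _ m0 m]) (use t x y Y in auto)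
        also have "\<dots> \<le> t powr v * M * C / (1 + y\<^sup>2)"
          using t C x M(2)[OF x] m0[of x]
          by (intro divide_right_mono mult_right_mono mult_mono powr_mono) auto
        also have "y\<^sup>2 = Y\<^sup>2" using y by auto
        finally show "norm (mellin_kernel \<phi> \<psi> t (Complex x y)) \<le> t powr v * M * C / (1 + Y\<^sup>2)" .
      qed (use v Y C m0 r in auto)
      also have "contour_integral (rectpath (Complex (-1/2) (-Y)) (Complex v Y)) (mellin_kernel \<phi> \<psi> t)
          = 2 * \<i> * of_real S"
        unfolding v_def S_def by (rule contour_integral_mellin_kernel) (use assms t Y in auto)
      finally show ?thesis by (simp add: norm_mult)
    qed
    \<comment> \<open>Letting \<open>Y\<close> tend to infinity removes the horizontal
      contribution.\<close>
    have "((\<lambda>Y. m (-1/2) * C * pi + t powr v * r * C * pi + 2 * (t powr v * M * C / (1 + Y\<^sup>2)) * (v - -1/2))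
      \<longlongrightarrow> m (-1/2) * C * pi + t powr v * r * C * pi + 2 * 0 * (v - -1/2)) at_top"
      by (intro tendsto_intros tendsto_divide_0[OF tendsto_const] filterlim_at_top_imp_at_infinity
          filterlim_tendsto_add_at_top[OF tendsto_const] filterlim_pow_at_top filterlim_ident) auto
    then have "2 * \<bar>S\<bar> \<le> m (-1/2) * C * pi + t powr v * r * C * pi + 2 * 0 * (v - -1/2)"
      by (rule tendsto_lowerbound) (use bound eventually_ge_at_top in \<open>auto intro: eventually_mono[OF eventually_ge_at_top[of 1]]\<close>)
    also have "t powr v = t powr (1/2) * t ^ N"
      using t by (simp add: v_def powr_add powr_realpow)
    also have "r = rGamma (\<phi> * real N + (\<phi> / 2 + \<psi>))" by (simp add: r_def v_def algebra_simps)
    finally show ?thesis by (simp add: S_def mult_ac)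
  qed
  show ?thesis by (rule that[OF _ _ main]) (use C m0[of "-1/2"] in auto)
qed

text \<open>For \<open>t \<ge> 1\<close> the limit \<open>N \<rightarrow> \<infinity>\<close> of the
  partial sum bound leaves \<open>A\<close>; on \<open>[0, 1]\<close> continuity suffices.\<close>

lemma mittag_leffler_real_bounded:
  assumes "0 < \<phi>" "\<phi> < 2" "\<psi> > 0"
  obtains B where "\<And>t. t \<ge> 0 \<Longrightarrow> \<bar>mittag_leffler_real \<phi> \<psi> (- t)\<bar> \<le> B"
proof -
  obtain A B where AB: "A \<ge> 0" "B \<ge> 0" "\<And>t N. t \<ge> 1 \<Longrightarrow> 1/2 \<le> \<phi> * real N \<Longrightarrow>
      \<bar>\<Sum>n\<le>N. rGamma (\<phi> * real n + \<psi>) * (- t) ^ n\<bar>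
        \<le> A + B * t powr (1/2) * (rGamma (\<phi> * real N + (\<phi> / 2 + \<psi>)) * t ^ N)"
    by (rule abs_mittag_leffler_partial_sum_le[OF assms]) blast
  have large: "\<bar>mittag_leffler_real \<phi> \<psi> (- t)\<bar> \<le> A" if t: "t \<ge> 1" for t
  proof -
    have "(\<lambda>N. \<bar>\<Sum>n\<le>N. rGamma (\<phi> * real n + \<psi>) * (- t) ^ n\<bar>) \<longlonglongrightarrow> \<bar>mittag_leffler_real \<phi> \<psi> (- t)\<bar>"
      unfolding mittag_leffler_real_def
      by (intro tendsto_rabs summable_LIMSEQ' summable_mittag_leffler assms)
    moreover have "(\<lambda>N. A + B * t powr (1/2) * (rGamma (\<phi> * real N + (\<phi> / 2 + \<psi>)) * t ^ N))
        \<longlonglongrightarrow> A + B * t powr (1/2) * 0"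
      by (intro tendsto_intros summable_LIMSEQ_zero summable_mittag_leffler assms)
    moreover have "\<forall>\<^sub>F N in sequentially. real N \<ge> 1 / 2 / \<phi>"
      by (rule eventually_ge_at_top[THEN eventually_compose_filterlim, OF filterlim_real_sequentially])
    then have "\<forall>\<^sub>F N in sequentially. \<bar>\<Sum>n\<le>N. rGamma (\<phi> * real n + \<psi>) * (- t) ^ n\<bar>
        \<le> A + B * t powr (1/2) * (rGamma (\<phi> * real N + (\<phi> / 2 + \<psi>)) * t ^ N)"
      by eventually_elim (rule AB(3)[OF t], use assms(1) in \<open>simp add: field_simps\<close>)
    ultimately have "\<bar>mittag_leffler_real \<phi> \<psi> (- t)\<bar> \<le> A + B * t powr (1/2) * 0"
      by (intro tendsto_le[OF sequentially_bot])
    then show ?thesis by simp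
  qed
  have "continuous_on {0..1} (\<lambda>t. mittag_leffler_real \<phi> \<psi> (- t))"
    by (intro continuous_at_imp_continuous_on ballI isCont_o2[OF _ isCont_mittag_leffler_real] assms continuous_intros)
  then have "bounded ((\<lambda>t. mittag_leffler_real \<phi> \<psi> (- t)) ` {0..1})"
    by (intro compact_imp_bounded compact_continuous_image) auto
  then obtain K where "\<forall>t\<in>{0..1}. \<bar>mittag_leffler_real \<phi> \<psi> (- t)\<bar> \<le> K"
    unfolding bounded_pos by auto
  then have "\<bar>mittag_leffler_real \<phi> \<psi> (- t)\<bar> \<le> max A K" if "t \<ge> 0" for t
    using large[of t] that by (cases "t \<ge> 1") (auto simp: le_max_iff_disj)
  then show ?thesis by (rule that)
qed

subsection \<open>The beta-logarithmic integral\<close>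

text \<open>The source of continuity of products, of pulling scalars out, and of a constant
  \<open>K\<close> bounding the norm of a product.\<close>

lemma bounded_bilinear_matrix_matrix_mult:
  "bounded_bilinear ((**) :: complex^'k^'k \<Rightarrow> complex^'k^'k \<Rightarrow> complex^'k^'k)"
proof (subst bilinear_conv_bounded_bilinear[symmetric], unfold bilinear_def, intro conjI allI linearI)
  fix x b1 b2 :: "complex^'k^'k" and r :: real
  show "x ** (b1 + b2) = x ** b1 + x ** b2" by (rule matrix_add_ldistrib)
  show "(b1 + b2) ** x = b1 ** x + b2 ** x" by (simp add: matrix_matrix_mult_def vec_eq_iff sum.distrib distrib_right)
  show "x ** (r *\<^sub>R b1) = r *\<^sub>R (x ** b1)"
    by (simp add: matrix_matrix_mult_def vec_eq_iff scaleR_sum_right)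
  show "(r *\<^sub>R b1) ** x = r *\<^sub>R (b1 ** x)"
    by (simp add: matrix_matrix_mult_def vec_eq_iff scaleR_sum_right)
qed

lemmas continuous_on_matrix_matrix_mult =
  bounded_bilinear.continuous_on[OF bounded_bilinear_matrix_matrix_mult]
lemmas scaleR_matrix_matrix_mult =
  bounded_bilinear.scaleR_left[OF bounded_bilinear_matrix_matrix_mult]
  bounded_bilinear.scaleR_right[OF bounded_bilinear_matrix_matrix_mult]

lemma beta_log_integrand_shift:
  assumes "P \<in> pos_stable_hermitian" "Q \<in> pos_stable_hermitian" "0 < x" "x < 1"
  shows "beta_log_integrand \<phi> \<psi> R S \<eta> \<xi> a b (P + real m *\<^sub>R mat 1) (Q + real n *\<^sub>R mat 1) x
    = (x ^ m * (1 - x) ^ n) *\<^sub>R beta_log_integrand \<phi> \<psi> R S \<eta> \<xi> a b P Q x"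
  using assms by (simp add: beta_log_integrand_def powr_matrix_shift scaleR_matrix_matrix_mult mult_ac)

section \<open>Integrability for \<open>\<phi> < 2\<close>\<close>

lemma powr_matrix_diff_mat_1:
  assumes "spectral_decomposition A L E" "x > 0"
  shows "powr_matrix x (A - mat 1) = (\<Sum>l\<in>L. (x powr (l - 1)) *\<^sub>R E l)"
  using powr_matrix_spectral[OF assms, of "-1"] by simp

lemma continuous_on_powr_matrix:
  fixes A :: "complex^'k^'k"
  assumes "A \<in> pos_stable_hermitian"
  shows "continuous_on {0<..} (\<lambda>x. powr_matrix x (A - mat 1))"
proof -
  obtain L E where E: "spectral_decomposition A L E" and "\<forall>l\<in>L. 0 < l"
    by (rule pos_stable_hermitian_spectral_decomposition[OF assms])
  have "continuous_on {0<..} (\<lambda>x. \<Sum>l\<in>L. (x powr (l - 1)) *\<^sub>R E l)"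
    by (intro continuous_intros) auto
  then show ?thesis
    by (rule continuous_on_eq) (simp add: powr_matrix_diff_mat_1[OF E])
qed

text \<open>For \<open>x < 1\<close> the smallest exponent dominates, and it exceeds -1 because the
  eigenvalues are positive.\<close>

lemma norm_powr_matrix_le:
  fixes A :: "complex^'k^'k"
  assumes "A \<in> pos_stable_hermitian"
  obtains p C where "p > 0" "C > 0"
    "\<And>x. 0 < x \<Longrightarrow> x < 1 \<Longrightarrow> norm (powr_matrix x (A - mat 1)) \<le> C * x powr (p - 1)"
proof -
  obtain L E where E: "spectral_decomposition A L E" and pos: "\<forall>l\<in>L. 0 < l"
    by (rule pos_stable_hermitian_spectral_decomposition[OF assms])
  have fin: "finite L" using E by (simp add: spectral_decomposition_def)
  \<comment> \<open>Inserting 1 makes \<open>Min\<close> meaningful without showing that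
    \<open>L\<close> is nonempty; likewise the summand 1 in \<open>C\<close> only secures
    positivity.\<close>
  define p where "p = Min (insert 1 L)"
  have p: "p > 0" "\<And>l. l \<in> L \<Longrightarrow> p \<le> l" using fin pos by (auto simp: p_def)
  define C where "C = (\<Sum>l\<in>L. norm (E l)) + 1"
  have C: "C > 0" by (simp add: C_def add_nonneg_pos sum_nonneg)
  have "norm (powr_matrix x (A - mat 1)) \<le> C * x powr (p - 1)" if x: "0 < x" "x < 1" for x
  proof -
    have "norm (powr_matrix x (A - mat 1)) \<le> (\<Sum>l\<in>L. norm (x powr (l - 1) *\<^sub>R E l))"
      unfolding powr_matrix_diff_mat_1[OF E x(1)] by (rule norm_sum)
    also have "\<dots> \<le> (\<Sum>l\<in>L. x powr (p - 1) * norm (E l))"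
      using x p by (intro sum_mono) (auto intro!: mult_right_mono powr_mono')
    also have "\<dots> = (C - 1) * x powr (p - 1)"
      by (simp add: C_def sum_distrib_left mult.commute)
    also have "\<dots> \<le> C * x powr (p - 1)" by (intro mult_right_mono) auto
    finally show ?thesis .
  qed
  then show ?thesis using that p(1) C by blast
qed

lemma mittag_leffler_spectral:
  fixes A :: "complex^'k^'k"
  assumes "spectral_decomposition A L E" "\<phi> > 0"
  shows "mittag_leffler \<phi> \<psi> (- (t *\<^sub>R A)) = (\<Sum>l\<in>L. mittag_leffler_real \<phi> \<psi> (- (t * l)) *\<^sub>R E l)"
  unfolding mittag_leffler_def
proof (rule matrix_power_series)
  show "matrix_power (- (t *\<^sub>R A)) n = (\<Sum>l\<in>L. ((- (t * l)) ^ n) *\<^sub>R E l)" for n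
    using assms(1)[unfolded spectral_decomposition_def, THEN conjunct2, rule_format, of "- t" 0 n] by simp
  show "(\<lambda>n. 1 / Gamma (\<phi> * real n + \<psi>) * (- (t * l)) ^ n) sums mittag_leffler_real \<phi> \<psi> (- (t * l))" for l
    using summable_sums[OF summable_mittag_leffler[OF assms(2), of \<psi> "- (t * l)"]]
    by (simp add: mittag_leffler_real_def rGamma_inverse_Gamma inverse_eq_divide)
qed

lemma continuous_on_mittag_leffler:
  fixes A :: "complex^'k^'k"
  assumes "A \<in> pos_stable_hermitian" "\<phi> > 0"
  shows "continuous_on UNIV (\<lambda>t. mittag_leffler \<phi> \<psi> (- (t *\<^sub>R A)))"
proof -
  obtain L E where E: "spectral_decomposition A L E" and "\<forall>l\<in>L. 0 < l"
    by (rule pos_stable_hermitian_spectral_decomposition[OF assms(1)])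
  have "continuous_on UNIV (mittag_leffler_real \<phi> \<psi>)"
    by (intro continuous_at_imp_continuous_on ballI isCont_mittag_leffler_real assms)
  then have "continuous_on UNIV (\<lambda>t. mittag_leffler_real \<phi> \<psi> (- (t * l)))" for l
    by (rule continuous_on_compose2) (auto intro!: continuous_intros)
  then show ?thesis
    unfolding mittag_leffler_spectral[OF E assms(2)]
    by (intro continuous_on_sum continuous_on_scaleR continuous_on_const)
qed

text \<open>Positive eigenvalues keep every \<open>- (t * l)\<close> on the negative axis, where the
  scalar function is bounded.\<close>

lemma norm_mittag_leffler_le:
  fixes A :: "complex^'k^'k"
  assumes "A \<in> pos_stable_hermitian" "0 < \<phi>" "\<phi> < 2" "\<psi> > 0"
  obtains B where "B > 0" "\<And>t. t \<ge> 0 \<Longrightarrow> norm (mittag_leffler \<phi> \<psi> (- (t *\<^sub>R A))) \<le> B"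
proof -
  obtain L E where E: "spectral_decomposition A L E" and pos: "\<forall>l\<in>L. 0 < l"
    by (rule pos_stable_hermitian_spectral_decomposition[OF assms(1)])
  obtain B where B: "\<And>t. t \<ge> 0 \<Longrightarrow> \<bar>mittag_leffler_real \<phi> \<psi> (- t)\<bar> \<le> B"
    using mittag_leffler_real_bounded[OF assms(2-4)] by blast
  have "norm (mittag_leffler \<phi> \<psi> (- (t *\<^sub>R A))) \<le> max 1 (\<Sum>l\<in>L. B * norm (E l))" if t: "t \<ge> 0" for t
  proof -
    have "norm (mittag_leffler \<phi> \<psi> (- (t *\<^sub>R A)))
        \<le> (\<Sum>l\<in>L. norm (mittag_leffler_real \<phi> \<psi> (- (t * l)) *\<^sub>R E l))"
      unfolding mittag_leffler_spectral[OF E assms(2)] by (rule norm_sum)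
    also have "\<dots> \<le> (\<Sum>l\<in>L. B * norm (E l))"
      using t pos by (intro sum_mono) (auto intro!: mult_right_mono B)
    finally show ?thesis by simp
  qed
  then show ?thesis by (intro that[of "max 1 (\<Sum>l\<in>L. B * norm (E l))"]) auto
qed

text \<open>The integrand is continuous on the open interval and dominated by a multiple of a Beta
  integrand: the Mittag-Leffler factors and the weight in \<open>a\<close>, \<open>b\<close> are
  bounded, and the matrix powers give the exponents \<open>p - 1\<close> and
  \<open>q - 1\<close>.\<close>

lemma beta_log_converges_if_less_2:
  fixes P Q R S :: "complex^'k^'k"
  assumes "0 < \<phi>" "\<phi> < 2" "\<psi> > 0" "a > 0" "b > 0"
    and P: "P \<in> pos_stable_hermitian" and Q: "Q \<in> pos_stable_hermitian"
    and R: "R \<in> pos_stable_hermitian" and S: "S \<in> pos_stable_hermitian"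
  shows "beta_log_converges \<phi> \<psi> R S \<eta> \<xi> a b P Q"
proof -
  let ?I = "{0<..<1::real}"
  let ?f = "beta_log_integrand \<phi> \<psi> R S \<eta> \<xi> a b P Q"
  obtain p Cp where p: "p > 0" "Cp > 0"
    "\<And>x. 0 < x \<Longrightarrow> x < 1 \<Longrightarrow> norm (powr_matrix x (P - mat 1)) \<le> Cp * x powr (p - 1)"
    using norm_powr_matrix_le[OF P] by blast
  obtain q Cq where q: "q > 0" "Cq > 0"
    "\<And>x. 0 < x \<Longrightarrow> x < 1 \<Longrightarrow> norm (powr_matrix x (Q - mat 1)) \<le> Cq * x powr (q - 1)"
    using norm_powr_matrix_le[OF Q] by blast
  obtain Br where Br: "Br > 0" "\<And>t. t \<ge> 0 \<Longrightarrow> norm (mittag_leffler \<phi> \<psi> (- (t *\<^sub>R R))) \<le> Br"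
    using norm_mittag_leffler_le[OF R assms(1-3)] by blast
  obtain Bs where Bs: "Bs > 0" "\<And>t. t \<ge> 0 \<Longrightarrow> norm (mittag_leffler \<phi> \<psi> (- (t *\<^sub>R S))) \<le> Bs"
    using norm_mittag_leffler_le[OF S assms(1-3)] by blast
  obtain K where K0: "K > 0"
    and "\<forall>(A :: complex^'k^'k) (B :: complex^'k^'k). norm (A ** B) \<le> norm A * norm B * K"
    using bounded_bilinear.pos_bounded[OF bounded_bilinear_matrix_matrix_mult] by blast
  then have K: "norm A * norm B * K \<le> c \<Longrightarrow> norm (A ** B) \<le> c" for A B :: "complex^'k^'k" and c
    by (meson order_trans)
  have prod4: "norm (A ** B ** C ** D) \<le> a' * b' * c' * d' * K ^ 3"
    if "norm A \<le> a'" "norm B \<le> b'" "norm C \<le> c'" "norm D \<le> d'" for A B C D :: "complex^'k^'k" and a' b' c' d'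
  proof -
    have pos: "a' \<ge> 0" "b' \<ge> 0" "c' \<ge> 0" "d' \<ge> 0"
      using that by (auto intro: order_trans[OF norm_ge_zero])
    have "norm (A ** B) \<le> a' * b' * K"
      using K0 that pos by (intro K mult_mono) auto
    then have "norm (A ** B ** C) \<le> (a' * b' * K) * c' * K"
      using K0 that pos by (intro K mult_mono) auto
    then have "norm (A ** B ** C ** D) \<le> ((a' * b' * K) * c' * K) * d' * K"
      using K0 that pos by (intro K mult_mono) auto
    then show ?thesis by (simp add: power3_eq_cube mult_ac)
  qed
  define G where "G = exp (\<bar>ln a\<bar> + \<bar>ln b\<bar>)"
  define C where "C = G * (Cp * Cq * Br * Bs * K ^ 3)"
  have bound: "norm (?f x) \<le> C * (x powr (p - 1) * (1 - x) powr (q - 1))" if x: "x \<in> ?I" for x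
  proof -
    have "c * y \<le> \<bar>y\<bar>" if "0 \<le> c" "c \<le> 1" for c y :: real
      using mult_left_mono[OF abs_ge_self[of y] that(1)] mult_left_le_one_le[OF abs_ge_zero[of y] that]
      by linarith
    then have "(1 - x) * ln a \<le> \<bar>ln a\<bar>" "x * ln b \<le> \<bar>ln b\<bar>" using x by auto
    then have ab: "\<bar>a powr (1 - x) * b powr x\<bar> \<le> G"
      using assms(4,5) by (simp add: G_def powr_def abs_mult exp_add[symmetric])
    have "norm (powr_matrix x (P - mat 1) ** powr_matrix (1 - x) (Q - mat 1)
         ** mittag_leffler \<phi> \<psi> (- ((1 / x powr \<eta>) *\<^sub>R R))
         ** mittag_leffler \<phi> \<psi> (- ((1 / (1 - x) powr \<xi>) *\<^sub>R S)))
       \<le> (Cp * x powr (p - 1)) * (Cq * (1 - x) powr (q - 1)) * Br * Bs * K ^ 3"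
      by (intro prod4 p q Br Bs) (use x in auto)
    then have "norm (?f x) \<le> G * ((Cp * x powr (p - 1)) * (Cq * (1 - x) powr (q - 1)) * Br * Bs * K ^ 3)"
      unfolding beta_log_integrand_def norm_scaleR by (intro mult_mono ab) (auto simp: G_def)
    then show ?thesis by (simp add: C_def mult_ac)
  qed
  have "continuous_on ?I ?f"
    unfolding beta_log_integrand_def[abs_def]
  proof (intro continuous_on_scaleR continuous_on_matrix_matrix_mult)
    show "continuous_on ?I (\<lambda>x. a powr (1 - x) * b powr x)"
      using assms(4,5) by (intro continuous_intros) auto
    show "continuous_on ?I (\<lambda>x. powr_matrix x (P - mat 1))"
      by (rule continuous_on_subset[OF continuous_on_powr_matrix[OF P]]) auto
    show "continuous_on ?I (\<lambda>x. powr_matrix (1 - x) (Q - mat 1))"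
      by (rule continuous_on_compose2[OF continuous_on_powr_matrix[OF Q]]) (auto intro!: continuous_intros)
    show "continuous_on ?I (\<lambda>x. mittag_leffler \<phi> \<psi> (- ((1 / x powr \<eta>) *\<^sub>R R)))"
      by (rule continuous_on_compose2[OF continuous_on_mittag_leffler[OF R assms(1)]])
         (auto intro!: continuous_intros)
    show "continuous_on ?I (\<lambda>x. mittag_leffler \<phi> \<psi> (- ((1 / (1 - x) powr \<xi>) *\<^sub>R S)))"
      by (rule continuous_on_compose2[OF continuous_on_mittag_leffler[OF S assms(1)]])
         (auto intro!: continuous_intros)
  qed
  then have meas: "?f \<in> borel_measurable (lebesgue_on ?I)"
    by (rule continuous_imp_measurable_on_sets_lebesgue) auto
  have "(\<lambda>x. x powr (p - 1) * (1 - x) powr (q - 1)) integrable_on ?I"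
    using has_integral_Beta_real[OF p(1) q(1)] by (auto simp: has_integral_Icc_iff_Ioo integrable_on_def)
  then have "(\<lambda>x. C * (x powr (p - 1) * (1 - x) powr (q - 1))) integrable_on ?I"
    by (drule_tac c = C in integrable_cmul) simp
  then have "?f integrable_on ?I"
    by (rule measurable_bounded_by_integrable_imp_integrable[OF meas _ bound]) auto
  then show ?thesis
    by (simp add: beta_log_converges_def integrable_on_Icc_iff_Ioo)
qed

theorem theorem3p2:
  fixes \<phi> \<psi> \<eta> \<xi> a b :: real
    and P Q R S :: "complex^'k^'k"
  assumes "\<phi> > 0" and "\<psi> > 0" and "\<eta> > 0" and "\<xi> > 0" and "a > 0" and "b > 0"
    and "P \<in> pos_stable_hermitian" and "Q \<in> pos_stable_hermitian"
    and "R \<in> pos_stable_hermitian" and "S \<in> pos_stable_hermitian"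
    and "\<phi> \<ge> 2 \<Longrightarrow> beta_log_converges \<phi> \<psi> R S \<eta> \<xi> a b P Q"
  shows "(\<lambda>n. beta_log \<phi> \<psi> R S \<eta> \<xi> a b (P + mat 1) (Q + real n *\<^sub>R mat 1))
           sums beta_log \<phi> \<psi> R S \<eta> \<xi> a b P Q
       \<and> (\<lambda>n. beta_log \<phi> \<psi> R S \<eta> \<xi> a b (P + real n *\<^sub>R mat 1) (Q + mat 1))
           sums beta_log \<phi> \<psi> R S \<eta> \<xi> a b P Q"
proof -
  \<comment> \<open>Convergence is proved for \<open>\<phi> < 2\<close> and is a hypothesis
    otherwise.\<close>
  have "beta_log_converges \<phi> \<psi> R S \<eta> \<xi> a b P Q"
    using beta_log_converges_if_less_2[of \<phi> \<psi> a b P Q R S \<eta> \<xi>] assms by (cases "\<phi> < 2") auto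
  then have int: "beta_log_integrand \<phi> \<psi> R S \<eta> \<xi> a b P Q integrable_on {0..1}"
    by (simp add: beta_log_converges_def)
  note shift = beta_log_integrand_shift[OF assms(7,8), of _ \<phi> \<psi> R S \<eta> \<xi> a b]
  show ?thesis
    unfolding beta_log_def
  proof
    show "(\<lambda>n. integral {0..1} (beta_log_integrand \<phi> \<psi> R S \<eta> \<xi> a b (P + mat 1) (Q + real n *\<^sub>R mat 1)))
      sums integral {0..1} (beta_log_integrand \<phi> \<psi> R S \<eta> \<xi> a b P Q)"
      \<comment> \<open>Raising \<open>P\<close> once and \<open>Q\<close> by \<open>n\<close> gives
        the factor \<open>x * (1 - x) ^ n\<close>, hence the reflected series.\<close>
      using shift[of _ 1] by (intro sums_integral_power_reflected[OF int]) simp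
    show "(\<lambda>n. integral {0..1} (beta_log_integrand \<phi> \<psi> R S \<eta> \<xi> a b (P + real n *\<^sub>R mat 1) (Q + mat 1)))
      sums integral {0..1} (beta_log_integrand \<phi> \<psi> R S \<eta> \<xi> a b P Q)"
      using shift[of _ _ 1] by (intro sums_integral_power[OF int]) (simp add: mult.commute)
  qed
qed

end
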